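(* Let $(\omega,c)\in\mathbb{R}^2$ satisfy: $\omega>c^2/4$, or $\omega=c^2/4$ and $c>0$. Then $$\lim_{L\to\infty}\bigl\|\Phi^L_{\omega,c}\bigr\|^2_{L^2(\mathbb{T}_{2L})}=\bigl\|\Phi_{\omega,c}\bigr\|^2_{L^2(\mathbb{R})}.$$
   Context: $\mathbb{T}_{2L}=\mathbb{R}/2L\mathbb{Z}\simeq[-L,L]$. Set $\alpha_0=\tfrac13(4c+\sqrt{48\omega+4c^2})$, $\alpha_1=4\sqrt\omega+2c$, $A(x)=-3x^2+8cx+64\omega$, $L_0(\omega,c)=2\pi/\sqrt{\alpha_0\sqrt{A(\alpha_0)}}$. For $\eta_3\in(\alpha_0,\alpha_1)$ put $\eta_1=\frac{-\eta_3+4c-\sqrt{A(\eta_3)}}{2}$, $\eta_2=\frac{-\eta_3+4c+\sqrt{A(\eta_3)}}{2}$, $k^2=\frac{-\eta_1(\eta_3-\eta_2)}{\eta_3(\eta_2-\eta_1)}\in(0,1)$, $g=\frac{2}{\sqrt{\eta_3(\eta_2-\eta_1)}}$, $\beta^2=-\eta_3k^2/\eta_1$, $T(\eta_3)=4gK(k)$ with $K(k)=\int_0^{\pi/2}(1-k^2\sin^2\theta)^{-1/2}d\theta$. The map $T$ is a strictly increasing bijection of $(\alpha_0,\alpha_1)$ onto $(2L_0,\infty)$; for $L>L_0$ let $\eta_3$ satisfy $T(\eta_3)=2L$, and let $\Phi^L_{\omega,c}>0$ be the $2L$-periodic function with $(\Phi^L_{\omega,c}(x))^2=\eta_3\,\mathrm{dn}^2(\frac{x}{2g};k)/(1+\beta^2\mathrm{sn}^2(\frac{x}{2g};k))$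 on $[-L,L]$ ($\mathrm{sn},\mathrm{dn}$ Jacobi elliptic functions of modulus $k$). $\Phi_{\omega,c}>0$ on $\mathbb{R}$ is given by $\Phi_{\omega,c}^2(x)=\frac{4\omega-c^2}{\sqrt\omega(\cosh(\sqrt{4\omega-c^2}x)-\frac{c}{2\sqrt\omega})}$ if $\omega>c^2/4$, and $\Phi_{\omega,c}^2(x)=\frac{4c}{(cx)^2+1}$ if $\omega=c^2/4,\ c>0$. *)

theory Defs
  imports "HOL-Analysis.Analysis"
begin

definition ell_F :: "real \<Rightarrow> real \<Rightarrow> real" where
  "ell_F k \<phi> =
     (if 0 \<le> \<phi> then integral {0..\<phi>} (\<lambda>\<theta>. 1 / sqrt (1 - k\<^sup>2 * (sin \<theta>)\<^sup>2))
      else - integral {\<phi>..0} (\<lambda>\<theta>. 1 / sqrt (1 - k\<^sup>2 * (sin \<theta>)\<^sup>2)))"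

definition ell_K :: "real \<Rightarrow> real" where
  "ell_K k = integral {0..pi/2} (\<lambda>\<theta>. 1 / sqrt (1 - k\<^sup>2 * (sin \<theta>)\<^sup>2))"

definition jacobi_am :: "real \<Rightarrow> real \<Rightarrow> real" where
  "jacobi_am k u = (THE \<phi>. ell_F k \<phi> = u)"

definition jacobi_sn :: "real \<Rightarrow> real \<Rightarrow> real" where
  "jacobi_sn k u = sin (jacobi_am k u)"

definition jacobi_dn :: "real \<Rightarrow> real \<Rightarrow> real" where
  "jacobi_dn k u = sqrt (1 - k\<^sup>2 * (jacobi_sn k u)\<^sup>2)"

definition alpha0 :: "real \<Rightarrow> real \<Rightarrow> real" where
  "alpha0 \<omega> c = (4*c + sqrt (48*\<omega> + 4*c\<^sup>2)) / 3"

definition alpha1 :: "real \<Rightarrow> real \<Rightarrow> real" where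
  "alpha1 \<omega> c = 4 * sqrt \<omega> + 2*c"

definition polyA :: "real \<Rightarrow> real \<Rightarrow> real \<Rightarrow> real" where
  "polyA \<omega> c x = -3*x\<^sup>2 + 8*c*x + 64*\<omega>"

definition L0 :: "real \<Rightarrow> real \<Rightarrow> real" where
  "L0 \<omega> c = 2*pi / sqrt (alpha0 \<omega> c * sqrt (polyA \<omega> c (alpha0 \<omega> c)))"

definition eta1 :: "real \<Rightarrow> real \<Rightarrow> real \<Rightarrow> real" where
  "eta1 \<omega> c e3 = (- e3 + 4*c - sqrt (polyA \<omega> c e3)) / 2"

definition eta2 :: "real \<Rightarrow> real \<Rightarrow> real \<Rightarrow> real" where
  "eta2 \<omega> c e3 = (- e3 + 4*c + sqrt (polyA \<omega> c e3)) / 2"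

definition modk :: "real \<Rightarrow> real \<Rightarrow> real \<Rightarrow> real" where
  "modk \<omega> c e3 = sqrt ((- eta1 \<omega> c e3 * (e3 - eta2 \<omega> c e3)) /
                         (e3 * (eta2 \<omega> c e3 - eta1 \<omega> c e3)))"

definition gpar :: "real \<Rightarrow> real \<Rightarrow> real \<Rightarrow> real" where
  "gpar \<omega> c e3 = 2 / sqrt (e3 * (eta2 \<omega> c e3 - eta1 \<omega> c e3))"

definition beta2 :: "real \<Rightarrow> real \<Rightarrow> real \<Rightarrow> real" where
  "beta2 \<omega> c e3 = - e3 * (modk \<omega> c e3)\<^sup>2 / eta1 \<omega> c e3"

definition Tper :: "real \<Rightarrow> real \<Rightarrow> real \<Rightarrow> real" where
  "Tper \<omega> c e3 = 4 * gpar \<omega> c e3 * ell_K (modk \<omega> c e3)"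

definition eta3L :: "real \<Rightarrow> real \<Rightarrow> real \<Rightarrow> real" where
  "eta3L \<omega> c L = (THE e3. alpha0 \<omega> c < e3 \<and> e3 < alpha1 \<omega> c \<and> Tper \<omega> c e3 = 2*L)"

definition PhiL :: "real \<Rightarrow> real \<Rightarrow> real \<Rightarrow> real \<Rightarrow> real" where
  "PhiL \<omega> c L x =
     (let e3 = eta3L \<omega> c L; k = modk \<omega> c e3; u = x / (2 * gpar \<omega> c e3) in
      sqrt (e3 * (jacobi_dn k u)\<^sup>2 / (1 + beta2 \<omega> c e3 * (jacobi_sn k u)\<^sup>2)))"

definition Phi :: "real \<Rightarrow> real \<Rightarrow> real \<Rightarrow> real" where
  "Phi \<omega> c x =
     (if \<omega> > c\<^sup>2/4 then
        sqrt ((4*\<omega> - c\<^sup>2) / (sqrt \<omega> * (cosh (sqrt (4*\<omega> - c\<^sup>2) * x) - c / (2 * sqrt \<omega>))))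
      else sqrt (4*c / ((c*x)\<^sup>2 + 1)))"

end

theory Submission
  imports Defs
begin

text \<open>
  Write \<open>J(P, Q)\<close> for the integral of \<open>(P cos\<^sup>2 \<theta> + Q sin\<^sup>2 \<theta>)\<^bsup>-1/2\<^esup>\<close> over \<open>[0, \<pi>/2]\<close>. The period is
  \<open>T = 8 J(P, Q)\<close> with \<open>P = \<eta>\<^sub>3 (\<eta>\<^sub>2 - \<eta>\<^sub>1)\<close> and \<open>Q = \<eta>\<^sub>2 (\<eta>\<^sub>3 - \<eta>\<^sub>1)\<close>. The substitution
  \<open>tan \<theta> = (P/Q)\<^bsup>1/4\<^esup> tan \<phi>\<close> shows that \<open>J\<close> decreases in \<open>P Q\<close> and \<open>P + Q\<close>; these are increasing
  polynomials in \<open>-\<eta>\<^sub>1\<close>, which decreases in \<open>\<eta>\<^sub>3\<close>. So \<open>T\<close> is strictly increasing, and it tends to infinity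
  as \<open>\<eta>\<^sub>3 \<rightarrow> \<alpha>\<^sub>1\<close> because \<open>Q \<rightarrow> 0\<close>. Hence \<open>\<eta>\<^sub>3 \<rightarrow> \<alpha>\<^sub>1\<close> as \<open>L \<rightarrow> \<infinity>\<close>.

  In the amplitude variable the mass is \<open>4 (\<eta>\<^sub>3/(\<eta>\<^sub>3 - \<eta>\<^sub>2))\<^bsup>1/2\<^esup>\<close> times the integral of
  \<open>\<beta> (1 - k\<^sup>2 sin\<^sup>2 \<phi>)\<^bsup>1/2\<^esup> / (1 + \<beta>\<^sup>2 sin\<^sup>2 \<phi>)\<close> over \<open>[-\<pi>/2, \<pi>/2]\<close>. Replacing the square root by
  \<open>cos \<phi>\<close> gives \<open>2 arctan \<beta>\<close>, with an error of at most \<open>\<pi> (1 - k\<^sup>2)\<^bsup>1/2\<^esup> / \<beta>\<close>, which vanishes as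
  \<open>\<eta>\<^sub>2 \<rightarrow> 0\<close> both for \<open>\<omega> > c\<^sup>2/4\<close> (where \<open>k \<rightarrow> 1\<close>) and for \<open>\<omega> = c\<^sup>2/4\<close> (where \<open>\<beta> \<rightarrow> \<infinity>\<close>).
\<close>

section \<open>Gauss's integral\<close>

lemma weighted_cos_sin_pos:
  fixes P Q x :: real
  assumes "0 < P" "0 < Q"
  shows "0 < P * (cos x)\<^sup>2 + Q * (sin x)\<^sup>2"
proof (cases "cos x = 0")
  case True
  then have "sin x \<noteq> 0" using sin_zero_abs_cos_one by fastforce
  then show ?thesis using True assms by simp
next
  case False
  then show ?thesis using assms by (intro add_pos_nonneg) auto
qed

definition gauss_integral :: "real \<Rightarrow> real \<Rightarrow> real" where
  "gauss_integral P Q = integral {0..pi/2} (\<lambda>\<theta>. 1 / sqrt (P * (cos \<theta>)\<^sup>2 + Q * (sin \<theta>)\<^sup>2))"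

lemma continuous_on_gauss_integrand:
  assumes "0 < P" "0 < Q"
  shows "continuous_on S (\<lambda>\<theta>. 1 / sqrt (P * (cos \<theta>)\<^sup>2 + Q * (sin \<theta>)\<^sup>2))"
proof -
  have "sqrt (P * (cos \<theta>)\<^sup>2 + Q * (sin \<theta>)\<^sup>2) \<noteq> 0" for \<theta>
    using weighted_cos_sin_pos[OF assms, of \<theta>] by simp
  then show ?thesis by (intro continuous_intros) auto
qed

text \<open>After the substitution \<open>P\<close> and \<open>Q\<close> enter only through
  \<open>sqrt (P*Q)\<close> and \<open>P + Q\<close>, both with nonnegative coefficients. Two such
  integrals can then be compared pointwise even when \<open>P\<close> and \<open>Q\<close> are not
  ordered separately.\<close>

lemma gauss_integral_symmetrized:
  assumes P: "0 < P" and Q: "0 < Q"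
  shows "gauss_integral P Q =
    integral {0..pi/2} (\<lambda>x. 1 / sqrt (sqrt (P*Q) * ((cos x)^4 + (sin x)^4) + (P+Q) * ((sin x)\<^sup>2 * (cos x)\<^sup>2)))"
proof -
  \<comment> \<open>For any positive \<open>l\<close>, substituting
    \<open>tan \<theta> = l * tan x\<close> leads to the radicand
    \<open>(P/l^2) * cos^4 + Q * l^2 * sin^4 + (P+Q) * sin^2 * cos^2\<close>. The fourth root of
    \<open>P/Q\<close> makes the first two coefficients equal.\<close>
  define a b l where "a = sqrt P" and "b = sqrt Q" and "l = sqrt (a/b)"
  have a: "a > 0" "a\<^sup>2 = P" and b: "b > 0" "b\<^sup>2 = Q" using P Q by (auto simp: a_def b_def)
  have l: "l > 0" "l\<^sup>2 = a/b" using a b by (auto simp: l_def)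
  define N where "N x = (cos x)\<^sup>2 + l\<^sup>2 * (sin x)\<^sup>2" for x
  have Npos: "N x > 0" for x
    using weighted_cos_sin_pos[of 1 "l\<^sup>2" x] l(1) by (simp add: N_def)
  define y where "y x = l * sin x / sqrt (N x)" for x
  \<comment> \<open>On the interval this is \<open>arctan (l * tan x)\<close>, written with
    \<open>arcsin\<close> so that it extends continuously to \<open>pi/2\<close>.\<close>
  define g where "g x = arcsin (y x)" for x
  define f where "f x = 1 / sqrt (P * (cos x)\<^sup>2 + Q * (sin x)\<^sup>2)" for x
  have y2: "1 - (y x)\<^sup>2 = (cos x)\<^sup>2 / N x" for x
    using Npos[of x] by (simp add: y_def power_divide power_mult_distrib field_simps) (simp add: N_def)
  have yb: "\<bar>y x\<bar> \<le> 1" for x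
  proof -
    have "0 \<le> 1 - (y x)\<^sup>2" unfolding y2 using Npos[of x] by simp
    then show ?thesis by (simp add: abs_square_le_1)
  qed
  have y1: "-1 \<le> y x" "y x \<le> 1" for x using yb[of x] by auto
  have dy: "(y has_real_derivative (l * cos x / (N x * sqrt (N x)))) (at x)" for x
  proof -
    have "(y has_real_derivative
       (l * cos x * sqrt (N x) - l * sin x * ((2 * l\<^sup>2 * sin x * cos x - 2 * cos x * sin x) / (2 * sqrt (N x)))) / N x) (at x)"
      unfolding y_def N_def
      using Npos[of x] unfolding N_def
      by (auto intro!: derivative_eq_intros simp: field_simps power2_eq_square)
    moreover have "(l * cos x * sqrt (N x) - l * sin x * ((2 * l\<^sup>2 * sin x * cos x - 2 * cos x * sin x) / (2 * sqrt (N x)))) / N x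
       = l * cos x / (N x * sqrt (N x))"
    proof -
      have "l * cos x * sqrt (N x) - l * sin x * ((2 * l\<^sup>2 * sin x * cos x - 2 * cos x * sin x) / (2 * sqrt (N x)))
        = (l * cos x * (N x) - l * sin x * (l\<^sup>2 * sin x * cos x - cos x * sin x)) / sqrt (N x)"
        using Npos[of x] by (simp add: field_simps)
      also have "l * cos x * (N x) - l * sin x * (l\<^sup>2 * sin x * cos x - cos x * sin x)
         = l * cos x * ((cos x)\<^sup>2 + (sin x)\<^sup>2)"
        unfolding N_def by algebra
      finally show ?thesis by simp
    qed
    ultimately show ?thesis by simp
  qed
  have cosg: "cos (g x) = cos x / sqrt (N x)" if "cos x \<ge> 0" for x
    using that Npos[of x] unfolding g_def cos_arcsin[OF y1] y2 by (simp add: real_sqrt_divide)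
  have sing: "sin (g x) = y x" for x
    unfolding g_def by (rule sin_arcsin[OF y1])
  have dg: "(g has_real_derivative (l / N x)) (at x within S)" if "cos x > 0" for x S
  proof -
    have *: "(y x)\<^sup>2 < 1" using y2[of x] that Npos[of x]
      by (smt (verit) divide_pos_pos zero_less_power2)
    then have lt: "-1 < y x" "y x < 1" by (auto simp: abs_square_less_1)
    have s: "sqrt (1 - (y x)\<^sup>2) = cos x / sqrt (N x)"
      using that Npos[of x] unfolding y2 by (simp add: real_sqrt_divide)
    have "(g has_real_derivative (inverse (sqrt (1 - (y x)\<^sup>2)) * (l * cos x / (N x * sqrt (N x))))) (at x)"
      unfolding g_def by (rule DERIV_chain2[OF DERIV_arcsin[OF lt] dy])
    also have "inverse (sqrt (1 - (y x)\<^sup>2)) * (l * cos x / (N x * sqrt (N x))) = l / N x"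
      unfolding s using that Npos[of x] by (simp add: field_simps)
    finally show ?thesis by (rule has_field_derivative_at_within)
  qed
  have "continuous_on {0..pi/2} y"
    using dy by (meson DERIV_isCont continuous_at_imp_continuous_on)
  then have contg: "continuous_on {0..pi/2} g"
    unfolding g_def by (intro continuous_on_arcsin) (use y1 in auto)
  have g0: "g 0 = 0" by (simp add: g_def y_def)
  have g1: "g (pi/2) = pi/2" using l(1) by (simp add: g_def y_def N_def)
  have cpos: "cos x > 0" if "x \<in> {0..pi/2} - {pi/2}" for x
    using that by (intro cos_gt_zero_pi) auto
  have "((\<lambda>x. (l / N x) *\<^sub>R f (g x)) has_integral (integral {g 0..g (pi/2)} f)) {0..pi/2}"
  \<comment> \<open>At \<open>pi/2\<close> the argument of \<open>arcsin\<close> reaches 1 and the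
    chain rule fails, so this point becomes the exceptional set.\<close>
  proof (rule has_integral_substitution_strong[where s="{pi/2}" and c="-(pi/2)" and d="pi/2"])
    show "g ` {0..pi/2} \<subseteq> {- (pi / 2)..pi / 2}"
      using arcsin_bounded y1 by (auto simp: g_def)
    show "continuous_on {- (pi / 2)..pi / 2} f"
      unfolding f_def using continuous_on_gauss_integrand[OF P Q] .
    show "\<And>x. x \<in> {0..pi / 2} - {pi / 2} \<Longrightarrow> (g has_real_derivative l / N x) (at x within {0..pi / 2})"
      using dg cpos by blast
  qed (auto simp: g0 g1 contg)
  then have "gauss_integral P Q = integral {0..pi/2} (\<lambda>x. (l / N x) *\<^sub>R f (g x))"
    unfolding g0 g1 gauss_integral_def f_def[abs_def] by (simp add: integral_unique)
  also have "\<dots> = integral {0..pi/2} (\<lambda>x. 1 / sqrt (sqrt (P*Q) * ((cos x)^4 + (sin x)^4) + (P+Q) * ((sin x)\<^sup>2 * (cos x)\<^sup>2)))"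
  proof (rule integral_cong)
    fix x assume "x \<in> {0..pi/2}"
    then have c: "cos x \<ge> 0" by (intro cos_ge_zero) auto
    \<comment> \<open>\<open>U\<close> is \<open>b * N x\<close>, and \<open>a * V\<close> is the
      numerator of the transformed radicand. Multiplying out \<open>U * V\<close> gives the
      symmetric form.\<close>
    define U V where "U = b * (cos x)\<^sup>2 + a * (sin x)\<^sup>2" and "V = a * (cos x)\<^sup>2 + b * (sin x)\<^sup>2"
    have UV: "U > 0" "V > 0" unfolding U_def V_def using a b by (auto intro: weighted_cos_sin_pos)
    have N: "N x = U / b" using b by (simp add: N_def U_def l field_simps)
    have "P * (cos (g x))\<^sup>2 + Q * (sin (g x))\<^sup>2 = a * V / N x"
    proof -
      have "P * (cos (g x))\<^sup>2 + Q * (sin (g x))\<^sup>2 = (P * (cos x)\<^sup>2 + Q * (l\<^sup>2 * (sin x)\<^sup>2)) / N x"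
        unfolding cosg[OF c] sing y_def using Npos[of x]
        by (simp add: power_divide power_mult_distrib add_divide_distrib)
      also have "P * (cos x)\<^sup>2 + Q * (l\<^sup>2 * (sin x)\<^sup>2) = a * V"
        using b(1) unfolding l(2) a(2)[symmetric] b(2)[symmetric] V_def
        by (simp add: field_simps power2_eq_square)
      finally show ?thesis .
    qed
    then have "(l / N x) *\<^sub>R f (g x) = l / (N x * sqrt (a * V / N x))" by (simp add: f_def)
    also have "N x * sqrt (a * V / N x) = sqrt (N x * (a * V))"
      using Npos[of x] by (simp add: real_sqrt_divide real_sqrt_mult field_simps)
    also have "N x * (a * V) = (a / b) * (U * V)" by (simp add: N)
    also have "l / sqrt ((a/b) * (U * V)) = 1 / sqrt (U * V)"
      using a(1) b(1) unfolding l_def real_sqrt_mult[of "a/b"] by simp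
    also have "U * V = sqrt (P*Q) * ((cos x)^4 + (sin x)^4) + (P+Q) * ((sin x)\<^sup>2 * (cos x)\<^sup>2)"
    proof -
      have "sqrt (P*Q) = a * b" by (simp add: a_def b_def real_sqrt_mult)
      then show ?thesis unfolding U_def V_def a(2)[symmetric] b(2)[symmetric] by algebra
    qed
    finally show "(l / N x) *\<^sub>R f (g x) = 1 / sqrt (sqrt (P*Q) * ((cos x)^4 + (sin x)^4) + (P+Q) * ((sin x)\<^sup>2 * (cos x)\<^sup>2))" .
  qed
  finally show ?thesis .
qed

lemma cos4_plus_sin4_pos: "0 < (cos x)^4 + (sin x)^4" for x :: real
proof (cases "cos x = 0")
  case True
  then have "sin x \<noteq> 0" using sin_zero_abs_cos_one by fastforce
  then show ?thesis using True by simp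
next
  case False
  then show ?thesis by (intro add_pos_nonneg) auto
qed

text \<open>In the symmetrized form the inequality holds between the integrands; it is strict
  because \<open>cos^4 + sin^4\<close> never vanishes.\<close>

lemma gauss_integral_less:
  assumes P: "0 < P" "0 < Q" "0 < P'" "0 < Q'"
    and le: "P * Q < P' * Q'" "P + Q < P' + Q'"
  shows "gauss_integral P' Q' < gauss_integral P Q"
proof -
  define X where "X p s x = p * ((cos x)^4 + (sin x)^4) + s * ((sin x)\<^sup>2 * (cos x)\<^sup>2)" for p s x :: real
  have pos: "X p s x > 0" if "p > 0" "s > 0" for p s x
    unfolding X_def using that by (intro add_pos_nonneg mult_pos_pos cos4_plus_sin4_pos) auto
  have cont: "continuous_on S (\<lambda>x. 1 / sqrt (X p s x))" if "p > 0" "s > 0" for p s S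
  proof -
    have "sqrt (X p s x) \<noteq> 0" for x using pos[OF that, of x] by simp
    then show ?thesis unfolding X_def by (intro continuous_intros) auto
  qed
  have "integral {0..pi/2} (\<lambda>x. 1 / sqrt (X (sqrt (P'*Q')) (P'+Q') x))
      < integral {0..pi/2} (\<lambda>x. 1 / sqrt (X (sqrt (P*Q)) (P+Q) x))"
  proof (rule integral_less_real)
    fix x :: real assume "x \<in> {0<..<pi/2}"
    have "X (sqrt (P*Q)) (P+Q) x < X (sqrt (P'*Q')) (P'+Q') x"
      unfolding X_def using le cos4_plus_sin4_pos[of x]
      by (intro add_less_le_mono mult_strict_right_mono mult_right_mono) auto
    moreover have "0 < X (sqrt (P*Q)) (P+Q) x" by (rule pos) (use P in auto)
    ultimately show "1 / sqrt (X (sqrt (P'*Q')) (P'+Q') x) < 1 / sqrt (X (sqrt (P*Q)) (P+Q) x)"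
      by (intro divide_strict_left_mono) auto
  next
    show "continuous_on {0..pi/2} (\<lambda>x. 1 / sqrt (X (sqrt (P'*Q')) (P'+Q') x))"
      by (rule cont) (use P in auto)
    show "continuous_on {0..pi/2} (\<lambda>x. 1 / sqrt (X (sqrt (P*Q)) (P+Q) x))"
      by (rule cont) (use P in auto)
    show "{0<..<pi/2} \<noteq> {}"
      unfolding greaterThanLessThan_empty_iff using pi_gt_zero by linarith
  qed
  then show ?thesis
    using P by (simp add: gauss_integral_symmetrized X_def)
qed

text \<open>Since \<open>cos x \<le> pi/2 - x\<close>, the square root in the integrand is at most
  the linear function \<open>sqrt M * (pi/2 - x) + sqrt Q\<close>, whose reciprocal integrates to a
  logarithm. The bound diverges as \<open>Q\<close> tends to 0 with \<open>M\<close> fixed.\<close>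

lemma gauss_integral_ge_log:
  assumes "0 < P" "0 < Q" "P \<le> M"
  shows "ln (1 + sqrt M * (pi/2) / sqrt Q) / sqrt M \<le> gauss_integral P Q"
proof -
  have M: "M > 0" using assms by simp
  define m q where "m = sqrt M" and "q = sqrt Q"
  have mq: "m > 0" "q > 0" "m\<^sup>2 = M" "q\<^sup>2 = Q" using M assms by (auto simp: m_def q_def)
  have den: "m * (pi/2 - x) + q > 0" if "x \<in> {0..pi/2}" for x
    using that mq by (intro add_nonneg_pos) auto
  have "((\<lambda>x. 1 / (m * (pi/2 - x) + q)) has_integral
      (- ln (m * (pi/2 - pi/2) + q) / m - (- ln (m * (pi/2 - 0) + q) / m))) {0..pi/2}"
  proof (rule fundamental_theorem_of_calculus)
    fix x assume x: "x \<in> {0..pi/2}"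
    show "((\<lambda>x. - ln (m * (pi/2 - x) + q) / m) has_vector_derivative 1 / (m * (pi/2 - x) + q)) (at x within {0..pi/2})"
      unfolding has_real_derivative_iff_has_vector_derivative[symmetric]
      using den[OF x] mq(1) by (auto intro!: derivative_eq_intros)
  qed simp
  moreover have "- ln (m * (pi/2 - pi/2) + q) / m - (- ln (m * (pi/2 - 0) + q) / m) = ln (1 + m * (pi/2) / q) / m"
  proof -
    have "ln (m * (pi/2) + q) - ln q = ln ((m * (pi/2) + q) / q)"
      using add_pos_pos[OF mult_pos_pos[OF mq(1) pi_half_gt_zero] mq(2)] mq(2)
      by (subst ln_div) auto
    also have "(m * (pi/2) + q) / q = 1 + m * (pi/2) / q" using mq by (simp add: field_simps)
    finally have "ln (m * (pi/2) + q) - ln q = ln (1 + m * (pi/2) / q)" .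
    then show ?thesis by (simp add: diff_divide_distrib[symmetric])
  qed
  ultimately have I: "((\<lambda>x. 1 / (m * (pi/2 - x) + q)) has_integral (ln (1 + m * (pi/2) / q) / m)) {0..pi/2}"
    by simp
  have "ln (1 + m * (pi/2) / q) / m \<le> gauss_integral P Q"
    unfolding gauss_integral_def
  proof (rule has_integral_le[OF I integrable_integral])
    show "(\<lambda>\<theta>. 1 / sqrt (P * (cos \<theta>)\<^sup>2 + Q * (sin \<theta>)\<^sup>2)) integrable_on {0..pi/2}"
      using assms by (intro integrable_continuous_real continuous_on_gauss_integrand)
    fix x assume x: "x \<in> {0..pi/2}"
    have c: "cos x = sin (pi/2 - x)" by (simp add: sin_cos_eq)
    have c1: "0 \<le> cos x" using x by (intro cos_ge_zero) auto
    have c2: "cos x \<le> pi/2 - x" unfolding c using x by (intro sin_x_le_x) auto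
    have "P * (cos x)\<^sup>2 + Q * (sin x)\<^sup>2 \<le> M * (cos x)\<^sup>2 + Q * 1"
      using assms by (intro add_mono mult_right_mono mult_left_mono) (auto simp: abs_square_le_1)
    also have "\<dots> \<le> (m * cos x + q)\<^sup>2"
      using mq c1 by (simp add: power2_sum power_mult_distrib)
    also have "\<dots> \<le> (m * (pi/2 - x) + q)\<^sup>2"
      using mq c1 c2 by (intro power_mono add_mono mult_left_mono) auto
    finally have "sqrt (P * (cos x)\<^sup>2 + Q * (sin x)\<^sup>2) \<le> m * (pi/2 - x) + q"
      using den[OF x] by (intro real_le_lsqrt) auto
    then show "1 / (m * (pi / 2 - x) + q) \<le> 1 / sqrt (P * (cos x)\<^sup>2 + Q * (sin x)\<^sup>2)"
      using weighted_cos_sin_pos[OF assms(1,2), of x] den[OF x] by (intro divide_left_mono) auto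
  qed
  then show ?thesis by (simp add: m_def q_def)
qed

lemma continuous_on_gauss_integral:
  fixes S :: "real set"
  assumes "continuous_on S p" "continuous_on S q" "\<And>x. x \<in> S \<Longrightarrow> 0 < p x" "\<And>x. x \<in> S \<Longrightarrow> 0 < q x"
  shows "continuous_on S (\<lambda>x. gauss_integral (p x) (q x))"
proof -
  have nz: "p (fst z) * (cos (snd z))\<^sup>2 + q (fst z) * (sin (snd z))\<^sup>2 \<noteq> 0"
    if "z \<in> S \<times> cbox 0 (pi/2)" for z
    using weighted_cos_sin_pos[of "p (fst z)" "q (fst z)" "snd z"] assms that by auto
  have "continuous_on S (\<lambda>x. integral (cbox 0 (pi/2))
     ((\<lambda>x \<theta>. 1 / sqrt (p x * (cos \<theta>)\<^sup>2 + q x * (sin \<theta>)\<^sup>2)) x))"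
    apply (rule integral_continuous_on_param)
    unfolding split_beta
    apply (intro continuous_intros continuous_on_compose2[OF assms(1)] continuous_on_compose2[OF assms(2)])
    using nz by (auto intro!: continuous_intros)
  then show ?thesis by (simp add: gauss_integral_def)
qed

section \<open>Incomplete elliptic integrals\<close>

context
  fixes k :: real
  assumes k: "k\<^sup>2 < 1"
begin

lemma one_minus_k2_sin2_pos: "0 < 1 - k\<^sup>2 * (sin \<theta>)\<^sup>2"
proof -
  have "k\<^sup>2 * (sin \<theta>)\<^sup>2 \<le> k\<^sup>2 * 1" by (intro mult_left_mono) (auto simp: abs_square_le_1)
  then show ?thesis using k by simp
qed

lemma continuous_on_ell_integrand: "continuous_on S (\<lambda>\<theta>. 1 / sqrt (1 - k\<^sup>2 * (sin \<theta>)\<^sup>2))"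
proof -
  have "sqrt (1 - k\<^sup>2 * (sin \<theta>)\<^sup>2) \<noteq> 0" for \<theta> using one_minus_k2_sin2_pos[of \<theta>] by simp
  then show ?thesis by (intro continuous_intros) auto
qed

text \<open>Removes the sign convention of \<open>ell_F\<close>: additivity of the integral settles
  each position of 0 relative to the interval.\<close>

lemma ell_F_diff:
  assumes "a \<le> b"
  shows "ell_F k b - ell_F k a = integral {a..b} (\<lambda>\<theta>. 1 / sqrt (1 - k\<^sup>2 * (sin \<theta>)\<^sup>2))"
proof -
  let ?f = "\<lambda>\<theta>. 1 / sqrt (1 - k\<^sup>2 * (sin \<theta>)\<^sup>2)"
  have comb: "integral {x..y} ?f + integral {y..z} ?f = integral {x..z} ?f" if "x \<le> y" "y \<le> z" for x y z
    using that by (intro Henstock_Kurzweil_Integration.integral_combine integrable_continuous_real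
        continuous_on_ell_integrand)
  consider "0 \<le> a" | "a < 0" "0 \<le> b" | "b < 0" by linarith
  then show ?thesis
  proof cases
    case 1
    then show ?thesis using assms comb[of 0 a b] by (simp add: ell_F_def)
  next
    case 2
    then show ?thesis using assms comb[of a 0 b] by (simp add: ell_F_def)
  next
    case 3
    then show ?thesis using assms comb[of a b 0] by (simp add: ell_F_def)
  qed
qed

lemma ell_F_strict_mono: "a < b \<Longrightarrow> ell_F k a < ell_F k b"
proof -
  assume ab: "a < b"
  have "integral {a..b} (\<lambda>_. 0) < integral {a..b} (\<lambda>\<theta>. 1 / sqrt (1 - k\<^sup>2 * (sin \<theta>)\<^sup>2))"
    using ab one_minus_k2_sin2_pos by (intro integral_less_real continuous_on_ell_integrand) auto
  then show ?thesis using ell_F_diff[of a b] ab by simp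
qed

text \<open>The argument already lies in the range of \<open>ell_F k\<close>, so a solution is at
  hand, and strict monotonicity supplies the uniqueness that the definite description
  requires.\<close>

lemma jacobi_am_ell_F: "jacobi_am k (ell_F k \<phi>) = \<phi>"
  unfolding jacobi_am_def
proof (rule the_equality)
  fix \<psi> assume "ell_F k \<psi> = ell_F k \<phi>"
  then show "\<psi> = \<phi>" using ell_F_strict_mono[of \<psi> \<phi>] ell_F_strict_mono[of \<phi> \<psi>] by linarith
qed simp

lemma ell_F_has_derivative:
  assumes "x \<in> {a..b}"
  shows "(ell_F k has_real_derivative 1 / sqrt (1 - k\<^sup>2 * (sin x)\<^sup>2)) (at x within {a..b})"
proof -
  let ?f = "\<lambda>\<theta>. 1 / sqrt (1 - k\<^sup>2 * (sin \<theta>)\<^sup>2)"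
  have "((\<lambda>x. ell_F k a + integral {a..x} ?f) has_real_derivative 0 + ?f x) (at x within {a..b})"
    by (intro DERIV_add DERIV_const integral_has_real_derivative continuous_on_ell_integrand assms)
  then have "((\<lambda>x. ell_F k a + integral {a..x} ?f) has_real_derivative ?f x) (at x within {a..b})" by simp
  moreover have "ell_F k a + integral {a..y} ?f = ell_F k y" if "y \<in> {a..b}" for y
    using ell_F_diff[of a y] that by simp
  ultimately show ?thesis
    by (rule has_field_derivative_transform_within[OF _ zero_less_one assms])
qed

lemma ell_F_half_pi: "ell_F k (pi/2) = ell_K k" "ell_F k (-(pi/2)) = - ell_K k"
proof -
  show "ell_F k (pi/2) = ell_K k" by (simp add: ell_F_def ell_K_def)
  have "integral {-(pi/2)..-0} (\<lambda>\<theta>. 1 / sqrt (1 - k\<^sup>2 * (sin (-\<theta>))\<^sup>2)) = ell_K k"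
    unfolding ell_K_def by (rule Henstock_Kurzweil_Integration.integral_reflect_real)
  moreover have "\<not> 0 \<le> -(pi/2)" using pi_gt_zero by linarith
  ultimately show "ell_F k (-(pi/2)) = - ell_K k" by (simp only: ell_F_def if_False) simp
qed

text \<open>The amplitude inverts \<open>ell_F k\<close>, so this is the change of variables
  \<open>x = 2 * g * ell_F k \<phi>\<close>. It removes the Jacobi functions from the mass.\<close>

lemma integral_jacobi_am:
  fixes h :: "real \<Rightarrow> real"
  assumes g: "g > 0" and h: "continuous_on UNIV h"
  shows "integral {-(2*g*ell_K k)..2*g*ell_K k} (\<lambda>x. h (jacobi_am k (x / (2*g))))
     = 2 * g * integral {-(pi/2)..pi/2} (\<lambda>\<phi>. h \<phi> / sqrt (1 - k\<^sup>2 * (sin \<phi>)\<^sup>2))"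
proof -
  define G where "G \<phi> = 2 * g * ell_F k \<phi>" for \<phi>
  define A where "A x = jacobi_am k (x / (2*g))" for x
  let ?I = "{-(pi/2)..pi/2}" and ?L = "2*g*ell_K k"
  have AG: "A (G \<phi>) = \<phi>" for \<phi> using g by (simp add: A_def G_def jacobi_am_ell_F)
  have dG: "(G has_real_derivative 2 * g * (1 / sqrt (1 - k\<^sup>2 * (sin x)\<^sup>2))) (at x within ?I)" if "x \<in> ?I" for x
    unfolding G_def by (intro DERIV_cmult ell_F_has_derivative that)
  then have cG: "continuous_on ?I G" by (rule DERIV_continuous_on)
  have mono: "G a \<le> G b" if "a \<le> b" for a b
    using ell_F_strict_mono[of a b] that g by (cases "a = b") (auto simp: G_def)
  have ends: "G (-(pi/2)) = - ?L" "G (pi/2) = ?L" by (simp_all add: G_def ell_F_half_pi)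
  have img: "G ` ?I = {- ?L..?L}"
  proof
    show "G ` ?I \<subseteq> {- ?L..?L}" using mono[of "-(pi/2)"] mono[of _ "pi/2"] by (auto simp: ends)
    show "{- ?L..?L} \<subseteq> G ` ?I"
    proof
      fix y assume "y \<in> {- ?L..?L}"
      then obtain x where "-(pi/2) \<le> x" "x \<le> pi/2" "G x = y"
        using IVT'[of G "-(pi/2)" y "pi/2"] cG by (auto simp: ends)
      then show "y \<in> G ` ?I" by auto
    qed
  qed
  \<comment> \<open>The inverse of a continuous injection on a compact interval is
    continuous.\<close>
  have "continuous_on (G ` ?I) A" by (rule continuous_on_inv[OF cG]) (auto simp: AG)
  then have cA: "continuous_on {- ?L..?L} (\<lambda>x. h (A x))"
    unfolding img by (rule continuous_on_compose2[OF h]) auto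
  have "((\<lambda>x. (2 * g * (1 / sqrt (1 - k\<^sup>2 * (sin x)\<^sup>2))) *\<^sub>R h (A (G x))) has_integral
       integral {G (-(pi/2))..G (pi/2)} (\<lambda>x. h (A x))) ?I"
    using mono img cA dG by (intro has_integral_substitution) auto
  then have "((\<lambda>x. 2 * g * (h x / sqrt (1 - k\<^sup>2 * (sin x)\<^sup>2))) has_integral
       integral {- ?L..?L} (\<lambda>x. h (A x))) ?I"
    unfolding ends AG by simp
  then have "integral {- ?L..?L} (\<lambda>x. h (A x)) = integral ?I (\<lambda>x. 2 * g * (h x / sqrt (1 - k\<^sup>2 * (sin x)\<^sup>2)))"
    by (simp add: integral_unique)
  then show ?thesis unfolding A_def by (simp only: integral_mult_right)
qed

text \<open>The comparison function \<open>cos \<phi> / (1 + B\<^sup>2 sin\<^sup>2 \<phi>)\<close> has the elementary primitive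
  \<open>arctan (B sin \<phi>) / B\<close>.\<close>

lemma third_kind_integral_approx:
  fixes B :: real
  assumes B: "B > 0"
  shows "\<bar>B * integral {-(pi/2)..pi/2} (\<lambda>\<phi>. sqrt (1 - k\<^sup>2 * (sin \<phi>)\<^sup>2) / (1 + B\<^sup>2 * (sin \<phi>)\<^sup>2)) - 2 * arctan B\<bar>
     \<le> pi * sqrt ((1 - k\<^sup>2) / B\<^sup>2)"
proof -
  let ?I = "{-(pi/2)..pi/2}"
  let ?f = "\<lambda>\<phi>. sqrt (1 - k\<^sup>2 * (sin \<phi>)\<^sup>2) / (1 + B\<^sup>2 * (sin \<phi>)\<^sup>2)"
  have den: "1 + B\<^sup>2 * (sin x)\<^sup>2 > 0" for x by (intro add_pos_nonneg) auto
  have I1: "((\<lambda>x. B * cos x / (1 + B\<^sup>2 * (sin x)\<^sup>2)) has_integral (arctan (B * sin (pi/2)) - arctan (B * sin (-(pi/2))))) ?I"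
  proof (rule fundamental_theorem_of_calculus)
    fix x :: real
    show "((\<lambda>x. arctan (B * sin x)) has_vector_derivative B * cos x / (1 + B\<^sup>2 * (sin x)\<^sup>2)) (at x within ?I)"
      unfolding has_real_derivative_iff_has_vector_derivative[symmetric]
      by (auto intro!: derivative_eq_intros simp: field_simps power_mult_distrib)
  qed simp
  have "continuous_on ?I ?f" using den by (intro continuous_intros) (auto simp: less_imp_neq[symmetric])
  then have "(?f has_integral integral ?I ?f) ?I"
    by (intro integrable_integral integrable_continuous_real)
  then have "((\<lambda>x. B * ?f x) has_integral B * integral ?I ?f) ?I" by (rule has_integral_mult_right)
  from has_integral_diff[OF this I1]
  have D: "((\<lambda>x. B * ?f x - B * cos x / (1 + B\<^sup>2 * (sin x)\<^sup>2)) has_integral B * integral ?I ?f - 2 * arctan B) ?I"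
    by (simp add: arctan_minus)
  let ?e = "sqrt ((1 - k\<^sup>2) / B\<^sup>2)"
  have "norm (B * integral ?I ?f - 2 * arctan B) \<le> ?e * measure lborel ?I"
  proof (rule has_integral_bound_real[OF _ finite.emptyI D])
    show "0 \<le> ?e" using k by auto
    fix x assume "x \<in> ?I - {}"
    then have x: "x \<in> ?I" by simp
    define X where "X = sqrt (1 - k\<^sup>2 * (sin x)\<^sup>2)"
    define m where "m = sqrt (1 - k\<^sup>2)"
    have c: "cos x \<ge> 0" using x by (intro cos_ge_zero) auto
    have m: "m > 0" "m\<^sup>2 = 1 - k\<^sup>2" using k by (auto simp: m_def)
    have X2: "X\<^sup>2 = 1 - k\<^sup>2 * (sin x)\<^sup>2" using one_minus_k2_sin2_pos[of x] by (simp add: X_def)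
    have "k\<^sup>2 * (sin x)\<^sup>2 \<le> k\<^sup>2 * 1" by (intro mult_left_mono) (auto simp: abs_square_le_1)
    then have Xm: "m \<le> X" unfolding m_def X_def by simp
    \<comment> \<open>Difference of squares: as \<open>X + cos x \<ge> m\<close>, it yields
      \<open>X - cos x \<le> m * (sin x)\<^sup>2\<close>.\<close>
    have eq: "(X - cos x) * (X + cos x) = m\<^sup>2 * (sin x)\<^sup>2"
    proof -
      have "(X - cos x) * (X + cos x) = X\<^sup>2 - (cos x)\<^sup>2" by algebra
      then show ?thesis by (simp add: X2 m cos_squared_eq algebra_simps)
    qed
    have "0 \<le> (X - cos x) * (X + cos x)" unfolding eq by simp
    then have ge: "0 \<le> X - cos x" using m Xm c
      by (smt (verit) zero_le_mult_iff)
    have "m * (X - cos x) \<le> (X + cos x) * (X - cos x)"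
      using ge Xm c by (intro mult_right_mono) auto
    also have "\<dots> = m * (m * (sin x)\<^sup>2)" using eq by (simp add: mult.commute power2_eq_square)
    finally have le: "X - cos x \<le> m * (sin x)\<^sup>2" using m(1) by simp
    have "B * ?f x - B * cos x / (1 + B\<^sup>2 * (sin x)\<^sup>2) = B * (X - cos x) / (1 + B\<^sup>2 * (sin x)\<^sup>2)"
      by (simp add: X_def right_diff_distrib diff_divide_distrib)
    moreover have "\<bar>B * (X - cos x) / (1 + B\<^sup>2 * (sin x)\<^sup>2)\<bar> \<le> m / B"
    proof -
      \<comment> \<open>The factor \<open>(sin x)\<^sup>2\<close> is absorbed by the denominator,
        which leaves a bound uniform in \<open>x\<close>.\<close>
      have "B * (X - cos x) * B \<le> B * (m * (sin x)\<^sup>2) * B" using le B by (intro mult_right_mono mult_left_mono) auto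
      also have "\<dots> \<le> m * (1 + B\<^sup>2 * (sin x)\<^sup>2)" using m by (simp add: algebra_simps power2_eq_square)
      finally have "B * (X - cos x) / (1 + B\<^sup>2 * (sin x)\<^sup>2) \<le> m / B"
        using B den[of x] by (simp add: field_simps)
      moreover have "0 \<le> B * (X - cos x) / (1 + B\<^sup>2 * (sin x)\<^sup>2)" using ge B den[of x] by simp
      ultimately show ?thesis by simp
    qed
    moreover have "m / B = ?e" using B by (simp add: m_def real_sqrt_divide)
    ultimately show "norm (B * ?f x - B * cos x / (1 + B\<^sup>2 * (sin x)\<^sup>2)) \<le> ?e" by simp
  qed
  then show ?thesis by (simp add: mult.commute)
qed

end

section \<open>The mass of the solitary waves on the real line\<close>

lemma integral_UNIV_FTC_nonneg:
  fixes f F :: "real \<Rightarrow> real"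
  assumes "\<And>x. (F has_real_derivative f x) (at x)" "continuous_on UNIV f" "\<And>x. 0 \<le> f x"
    and "(F \<longlongrightarrow> A) at_bot" "(F \<longlongrightarrow> B) at_top"
  shows "integral UNIV f = B - A"
proof -
  have A: "((F \<circ> real_of_ereal) \<longlongrightarrow> A) (at_right (-\<infinity>))"
    and B: "((F \<circ> real_of_ereal) \<longlongrightarrow> B) (at_left \<infinity>)"
    using assms(4,5) by (simp_all add: ereal_tendsto_simps)
  have cont: "isCont f x" for x using assms(2) by (simp add: continuous_on_eq_continuous_at)
  \<comment> \<open>For a nonnegative integrand, finite limits of the primitive at both ends already
    give integrability on the whole line.\<close>
  note * = interval_integral_FTC_nonneg[of "-\<infinity>" "\<infinity>" F f A B, OF _ assms(1) cont _ A B]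
  have 1: "set_integrable lborel UNIV f" and 2: "(LBINT x=-\<infinity>..\<infinity>. f x) = B - A"
    using * assms(3) by auto
  have "integral UNIV f = (LBINT x:UNIV. f x)"
    using set_borel_integral_eq_integral(2)[OF 1] by simp
  also have "\<dots> = B - A" using 2 by (simp add: interval_lebesgue_integral_def)
  finally show ?thesis .
qed

lemma integral_Phi_algebraic:
  assumes "\<omega> = c\<^sup>2/4" "c > 0"
  shows "integral UNIV (\<lambda>x. (Phi \<omega> c x)\<^sup>2) = 4 * pi"
proof -
  have eq: "(Phi \<omega> c x)\<^sup>2 = 4*c / ((c*x)\<^sup>2 + 1)" for x
    using assms by (simp add: Phi_def add_nonneg_pos)
  have nz: "(c*x)\<^sup>2 + 1 \<noteq> 0" for x by (smt (verit) zero_le_power2)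
  have top: "LIM x at_top. c * x :> at_top" and bot: "LIM x at_bot. c * x :> at_bot"
    using assms by (auto intro!: filterlim_tendsto_pos_mult_at_top filterlim_tendsto_pos_mult_at_bot filterlim_ident)
  have "integral UNIV (\<lambda>x. 4*c / ((c*x)\<^sup>2 + 1)) = 4 * (pi/2) - 4 * (-(pi/2))"
  proof (rule integral_UNIV_FTC_nonneg)
    show "((\<lambda>x. 4 * arctan (c*x)) has_real_derivative 4*c / ((c*x)\<^sup>2 + 1)) (at x)" for x
      by (auto intro!: derivative_eq_intros simp: field_simps)
    show "continuous_on UNIV (\<lambda>x. 4*c / ((c*x)\<^sup>2 + 1))" using nz by (intro continuous_intros) auto
    show "((\<lambda>x. 4 * arctan (c*x)) \<longlongrightarrow> 4 * (-(pi/2))) at_bot"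
      by (intro tendsto_intros filterlim_compose[OF tendsto_arctan_at_bot bot])
    show "((\<lambda>x. 4 * arctan (c*x)) \<longlongrightarrow> 4 * (pi/2)) at_top"
      by (intro tendsto_intros filterlim_compose[OF tendsto_arctan_at_top top])
  qed (use assms in auto)
  then show ?thesis by (simp add: eq)
qed

text \<open>In terms of the half argument the integrand is rational in \<open>tanh\<close>, and
  \<open>4 * arctan (sqrt b * tanh (s*x/2))\<close> is a primitive, where \<open>b\<close> is the
  quotient under the square root of the result.\<close>

lemma integral_Phi_hyperbolic:
  assumes "\<omega> > c\<^sup>2/4"
  shows "integral UNIV (\<lambda>x. (Phi \<omega> c x)\<^sup>2) = 8 * arctan (sqrt ((2 * sqrt \<omega> + c) / (2 * sqrt \<omega> - c)))"
proof -
  define r s b where "r = sqrt \<omega>" and "s = sqrt (4*\<omega> - c\<^sup>2)" and "b = (2*r+c)/(2*r-c)"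
  have w: "\<omega> > 0" using assms by (smt (verit) zero_le_power2 divide_nonneg_pos)
  have r: "r > 0" "r\<^sup>2 = \<omega>" using w by (auto simp: r_def)
  have "\<bar>c\<bar> < 2 * r"
    using assms r by (intro power2_less_imp_less[of "\<bar>c\<bar>" "2*r"]) (auto simp: power_mult_distrib)
  then have rc: "2*r + c > 0" "2*r - c > 0" by auto
  have b: "b > 0" using rc by (simp add: b_def)
  have s2: "s\<^sup>2 = (2*r+c)*(2*r-c)"
    using assms by (simp add: s_def r(2)[symmetric] power2_eq_square algebra_simps)
  have s: "s > 0" using assms by (simp add: s_def)
  \<comment> \<open>This relation makes the constant in the derivative of the primitive agree with
    \<open>s\<^sup>2\<close>.\<close>
  have sb: "s = sqrt b * (2*r - c)"
  proof (rule power2_eq_imp_eq)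
    show "s\<^sup>2 = (sqrt b * (2*r - c))\<^sup>2"
      using b rc by (simp add: s2 power_mult_distrib) (simp add: b_def power2_eq_square)
  qed (use s b rc in auto)
  have den: "cosh y - c / (2*r) > 0" for y :: real
  proof -
    have "c / (2*r) < 1" using rc r by simp
    moreover have "1 \<le> cosh y" by (rule cosh_real_ge_1)
    ultimately show ?thesis by linarith
  qed
  have eq: "(Phi \<omega> c x)\<^sup>2 = s\<^sup>2 / (r * (cosh (s * x) - c / (2*r)))" for x
    using assms den[of "s*x"] r by (simp add: Phi_def s_def r_def)
  \<comment> \<open>Multiplying the constant term by \<open>cosh^2 - sinh^2 = 1\<close> turns the
    denominator into a quadratic form in the half-argument functions.\<close>
  have fac: "r * (cosh (s * x) - c / (2*r)) = (2*r-c)/2 * ((cosh (s*x/2))\<^sup>2 + b * (sinh (s*x/2))\<^sup>2)" for x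
  proof -
    have "cosh (s*x) = (cosh (s*x/2))\<^sup>2 + (sinh (s*x/2))\<^sup>2" using cosh_double[of "s*x/2"] by simp
    moreover have "(2*r-c) * b = 2*r+c" using rc by (simp add: b_def)
    moreover have "(cosh (s*x/2))\<^sup>2 = (sinh (s*x/2))\<^sup>2 + 1" by (rule cosh_square_eq)
    ultimately show ?thesis using r by (simp add: field_simps) algebra
  qed
  have "((\<lambda>x. 4 * arctan (sqrt b * tanh (s/2 * x))) has_real_derivative s\<^sup>2 / (r * (cosh (s * x) - c / (2*r)))) (at x)" for x
  proof -
    define C S where "C = cosh (s*x/2)" and "S = sinh (s*x/2)"
    have C: "C > 0" by (simp add: C_def)
    have CS: "C\<^sup>2 = S\<^sup>2 + 1" by (simp add: C_def S_def cosh_square_eq)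
    have pos: "C\<^sup>2 + b * S\<^sup>2 > 0" using C b by (intro add_pos_nonneg) auto
    have "((\<lambda>x. 4 * arctan (sqrt b * tanh (s/2 * x))) has_real_derivative
       4 * (inverse (1 + (sqrt b * tanh (s/2*x))\<^sup>2) * (sqrt b * ((1 - (tanh (s/2*x))\<^sup>2) * (s/2))))) (at x)"
    proof -
      have "((\<lambda>x. tanh (s/2*x)) has_real_derivative (1 - (tanh (s/2*x))\<^sup>2) * (s/2)) (at x)"
        using cosh_real_pos[of "s/2*x"] by (auto intro!: derivative_eq_intros)
      then show ?thesis
        by (intro DERIV_cmult DERIV_chain2[OF DERIV_arctan])
    qed
    moreover have "4 * (inverse (1 + (sqrt b * tanh (s/2*x))\<^sup>2) * (sqrt b * ((1 - (tanh (s/2*x))\<^sup>2) * (s/2))))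
       = s\<^sup>2 / (r * (cosh (s * x) - c / (2*r)))"
    proof -
      have t: "tanh (s/2*x) = S / C" by (simp add: tanh_def S_def C_def)
      have "1 - (S/C)\<^sup>2 = (C\<^sup>2 - S\<^sup>2) / C\<^sup>2" using C by (simp add: power_divide diff_divide_distrib)
      then have 1: "1 - (S/C)\<^sup>2 = 1 / C\<^sup>2" by (simp add: CS)
      have 2: "1 + (sqrt b * (S/C))\<^sup>2 = (C\<^sup>2 + b * S\<^sup>2) / C\<^sup>2"
        using C b by (simp add: power_divide power_mult_distrib field_simps)
      have "4 * (inverse (1 + (sqrt b * (S/C))\<^sup>2) * (sqrt b * ((1 - (S/C)\<^sup>2) * (s/2)))) = 2 * sqrt b * s / (C\<^sup>2 + b * S\<^sup>2)"
        unfolding 1 2 using C pos by (simp add: field_simps)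
      also have "\<dots> = s * (sqrt b * (2*r-c)) / ((2*r-c)/2 * (C\<^sup>2 + b * S\<^sup>2))"
      proof -
        have "2 * w * s / D = s * (w * d) / (d/2 * D)" if "d \<noteq> 0" "D \<noteq> 0" for w d D
          using that by (simp add: field_simps)
        then show ?thesis using pos rc by simp
      qed
      also have "\<dots> = s\<^sup>2 / ((2*r-c)/2 * (C\<^sup>2 + b * S\<^sup>2))" unfolding sb[symmetric] by (simp add: power2_eq_square)
      finally show ?thesis unfolding t fac C_def S_def .
    qed
    ultimately show ?thesis by simp
  qed
  moreover have "continuous_on UNIV (\<lambda>x. s\<^sup>2 / (r * (cosh (s * x) - c / (2*r))))"
    using den r by (intro continuous_intros) (auto simp: less_imp_neq[symmetric])
  moreover have top: "LIM x at_top. s/2 * x :> at_top" and bot: "LIM x at_bot. s/2 * x :> at_bot"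
    using s by (intro filterlim_tendsto_pos_mult_at_top[OF tendsto_const] filterlim_tendsto_pos_mult_at_bot[OF tendsto_const]
        filterlim_ident; simp)+
  then have "((\<lambda>x. 4 * arctan (sqrt b * tanh (s/2 * x))) \<longlongrightarrow> 4 * arctan (sqrt b * (-1))) at_bot"
       "((\<lambda>x. 4 * arctan (sqrt b * tanh (s/2 * x))) \<longlongrightarrow> 4 * arctan (sqrt b * 1)) at_top"
    by (intro tendsto_intros filterlim_compose[OF tanh_real_at_bot bot] filterlim_compose[OF tanh_real_at_top top])+
  ultimately have "integral UNIV (\<lambda>x. s\<^sup>2 / (r * (cosh (s * x) - c / (2*r)))) = 4 * arctan (sqrt b * 1) - 4 * arctan (sqrt b * (-1))"
    using den r by (intro integral_UNIV_FTC_nonneg) (auto intro!: divide_nonneg_pos)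
  then show ?thesis by (simp add: eq arctan_minus b_def r_def)
qed

section \<open>The period function and the mass\<close>

lemma arctan_reciprocal:
  assumes "0 < x"
  shows "arctan (1 / x) = pi/2 - arctan x"
  using arctan_inverse[of x] assms by (simp add: inverse_eq_divide)

context
  fixes \<omega> c :: real
  assumes adm: "\<omega> > c\<^sup>2/4 \<or> (\<omega> = c\<^sup>2/4 \<and> c > 0)"
begin

section \<open>Admissible parameters and the order of the roots\<close>

lemma omega_pos: "0 < \<omega>"
  using adm by (smt (verit) zero_le_power2 divide_nonneg_pos zero_less_power divide_pos_pos)

text \<open>Equality \<open>c = 2 * sqrt \<omega>\<close> is the algebraic case. There
  \<open>c\<close> is positive, which keeps the other bound strict.\<close>

lemma sqrt_omega_bounds:
  shows "0 < sqrt \<omega>" "0 < 2 * sqrt \<omega> + c" "c \<le> 2 * sqrt \<omega>"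
proof -
  show p: "0 < sqrt \<omega>" using omega_pos by simp
  have "\<bar>c\<bar> \<le> 2 * sqrt \<omega>"
    using adm omega_pos by (intro power2_le_imp_le[of "\<bar>c\<bar>"]) (auto simp: power_mult_distrib)
  then show "c \<le> 2 * sqrt \<omega>" by simp
  show "0 < 2 * sqrt \<omega> + c"
  proof (cases "c > 0")
    case True
    then show ?thesis using p by linarith
  next
    case False
    then have "\<bar>c\<bar> < 2 * sqrt \<omega>"
      using adm omega_pos by (intro power2_less_imp_less[of "\<bar>c\<bar>"]) (auto simp: power_mult_distrib)
    then show ?thesis by simp
  qed
qed

lemma alpha_bounds: "0 < alpha1 \<omega> c" "alpha0 \<omega> c < alpha1 \<omega> c"
proof -
  let ?r = "sqrt \<omega>"
  note r = sqrt_omega_bounds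
  have r2: "?r\<^sup>2 = \<omega>" using omega_pos by simp
  show "0 < alpha1 \<omega> c" using r by (simp add: alpha1_def)
  have "sqrt (48*\<omega> + 4*c\<^sup>2) < 12 * ?r + 2 * c"
  proof (rule real_less_lsqrt)
    show "0 \<le> 12 * ?r + 2 * c" using r by linarith
    have "(12 * ?r + 2 * c)\<^sup>2 = 48*\<omega> + 4*c\<^sup>2 + 48 * ?r * (2 * ?r + c)"
      using r2 by (simp add: power2_eq_square algebra_simps)
    then show "48*\<omega> + 4*c\<^sup>2 < (12 * ?r + 2 * c)\<^sup>2"
      using mult_pos_pos[OF r(1,2)] by simp
  qed
  then show "alpha0 \<omega> c < alpha1 \<omega> c" by (simp add: alpha0_def alpha1_def)
qed

text \<open>Exhibits \<open>polyA\<close> as the discriminant of the quadratic with root sum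
  \<open>4*c - e\<close> and root product \<open>(e - 2*c)\<^sup>2 - 16*\<omega>\<close>, whose
  roots are \<open>eta1\<close> and \<open>eta2\<close>.\<close>

lemma polyA_eq: "polyA \<omega> c e = (e - 4*c)\<^sup>2 - 4 * ((e - 2*c)\<^sup>2 - 16*\<omega>)"
  unfolding polyA_def by algebra

text \<open>From \<open>\<bar>e - 2*c\<bar> < 4 * sqrt \<omega>\<close> the product of the two roots
  is negative, which fixes their signs. The number \<open>alpha0\<close> is the larger solution of
  \<open>polyA \<omega> c e = (3*e - 4*c)\<^sup>2\<close>, that is, the threshold beyond which
  \<open>eta2\<close> stays below \<open>e\<close>.\<close>

lemma eta_ordering:
  assumes e: "alpha0 \<omega> c < e" "e < alpha1 \<omega> c"
  shows "0 < e" "0 < polyA \<omega> c e" "eta1 \<omega> c e < 0" "0 < eta2 \<omega> c e" "eta2 \<omega> c e < e"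
proof -
  let ?r = "sqrt \<omega>" and ?s = "sqrt (48*\<omega> + 4*c\<^sup>2)"
  note r = sqrt_omega_bounds
  have r2: "?r\<^sup>2 = \<omega>" using omega_pos by simp
  have s2: "?s\<^sup>2 = 48*\<omega> + 4*c\<^sup>2" using omega_pos by simp
  have "(4*c)\<^sup>2 \<le> ?s\<^sup>2" unfolding s2 using adm by auto
  then have sc: "4 * \<bar>c\<bar> \<le> ?s" using omega_pos by (intro power2_le_imp_le[of "4*\<bar>c\<bar>"]) auto
  have s0: "?s > 0" using omega_pos by (simp add: add_pos_nonneg)
  have e3: "3 * e > 4*c + ?s" using e by (simp add: alpha0_def field_simps)
  then show epos: "0 < e" using sc by linarith
  have lo: "e - 2*c > - (4 * ?r)" using e3 sc r by linarith
  have hi: "e - 2*c < 4 * ?r" using e by (simp add: alpha1_def)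
  have "(e - 2*c)\<^sup>2 < (4 * ?r)\<^sup>2"
    using lo hi by (intro power2_strict_mono) auto
  then have neg: "(e - 2*c)\<^sup>2 < 16 * \<omega>" by (simp add: power_mult_distrib r2)
  then have A: "(e - 4*c)\<^sup>2 < polyA \<omega> c e" by (simp add: polyA_eq)
  then show "0 < polyA \<omega> c e" by (smt (verit) zero_le_power2)
  have "\<bar>e - 4*c\<bar> < sqrt (polyA \<omega> c e)" using A by (intro real_less_rsqrt) simp
  then show "eta1 \<omega> c e < 0" "0 < eta2 \<omega> c e" by (auto simp: eta1_def eta2_def)
  have "?s\<^sup>2 < (3*e - 4*c)\<^sup>2" using e3 s0 by (intro power_strict_mono) auto
  then have "polyA \<omega> c e < (3*e - 4*c)\<^sup>2"
    unfolding s2 polyA_def by (simp add: power2_eq_square algebra_simps)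
  moreover have "0 < 3*e - 4*c" using e3 s0 by linarith
  ultimately have "sqrt (polyA \<omega> c e) < 3*e - 4*c" by (intro real_less_lsqrt) auto
  then show "eta2 \<omega> c e < e" by (simp add: eta2_def)
qed

lemma eta_sum: "eta1 \<omega> c e + eta2 \<omega> c e = 4*c - e"
  by (simp add: eta1_def eta2_def field_simps)

lemma eta_prod:
  assumes "0 \<le> polyA \<omega> c e"
  shows "eta1 \<omega> c e * eta2 \<omega> c e = (e - 2*c)\<^sup>2 - 16*\<omega>"
proof -
  have "4 * (eta1 \<omega> c e * eta2 \<omega> c e) = (e - 4*c)\<^sup>2 - (sqrt (polyA \<omega> c e))\<^sup>2"
    unfolding eta1_def eta2_def by (simp add: field_simps power2_eq_square)
  then show ?thesis using assms by (simp add: polyA_eq)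
qed

lemma modk_sq:
  assumes e: "alpha0 \<omega> c < e" "e < alpha1 \<omega> c"
  shows "(modk \<omega> c e)\<^sup>2 = - eta1 \<omega> c e * (e - eta2 \<omega> c e) / (e * (eta2 \<omega> c e - eta1 \<omega> c e))"
proof -
  note o = eta_ordering[OF e]
  have "0 \<le> - eta1 \<omega> c e * (e - eta2 \<omega> c e) / (e * (eta2 \<omega> c e - eta1 \<omega> c e))"
    using o by (intro divide_nonneg_pos mult_nonneg_nonneg mult_pos_pos) auto
  then show ?thesis unfolding modk_def by (simp only: real_sqrt_pow2)
qed

lemma one_minus_modk_sq:
  assumes e: "alpha0 \<omega> c < e" "e < alpha1 \<omega> c"
  shows "1 - (modk \<omega> c e)\<^sup>2 = eta2 \<omega> c e * (e - eta1 \<omega> c e) / (e * (eta2 \<omega> c e - eta1 \<omega> c e))"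
proof -
  note o = eta_ordering[OF e]
  have "1 - u / d = v / d" if "d \<noteq> 0" "d - u = v" for u v d :: real
    using that by (auto simp: diff_divide_distrib)
  note this[of "e * (eta2 \<omega> c e - eta1 \<omega> c e)" "- eta1 \<omega> c e * (e - eta2 \<omega> c e)"
      "eta2 \<omega> c e * (e - eta1 \<omega> c e)"]
  then show ?thesis
    unfolding modk_sq[OF e] using o by (simp add: left_diff_distrib right_diff_distrib)
qed

lemma modk_sq_less_one:
  assumes e: "alpha0 \<omega> c < e" "e < alpha1 \<omega> c"
  shows "(modk \<omega> c e)\<^sup>2 < 1"
proof -
  note o = eta_ordering[OF e]
  have "0 < eta2 \<omega> c e * (e - eta1 \<omega> c e) / (e * (eta2 \<omega> c e - eta1 \<omega> c e))"
    using o by (intro divide_pos_pos mult_pos_pos) auto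
  then show ?thesis using one_minus_modk_sq[OF e] by linarith
qed

lemma beta2_eq:
  assumes e: "alpha0 \<omega> c < e" "e < alpha1 \<omega> c"
  shows "beta2 \<omega> c e = (e - eta2 \<omega> c e) / (eta2 \<omega> c e - eta1 \<omega> c e)"
proof -
  note o = eta_ordering[OF e]
  have "beta2 \<omega> c e = (- e * - eta1 \<omega> c e * (e - eta2 \<omega> c e)) / (eta1 \<omega> c e * e * (eta2 \<omega> c e - eta1 \<omega> c e))"
    unfolding beta2_def modk_sq[OF e] by simp
  also have "\<dots> = (e - eta2 \<omega> c e) / (eta2 \<omega> c e - eta1 \<omega> c e)" using o by simp
  finally show ?thesis .
qed

section \<open>The period as a Gauss integral\<close>

definition quadP :: "real \<Rightarrow> real" where
  "quadP e = e * (eta2 \<omega> c e - eta1 \<omega> c e)"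

text \<open>On the admissible interval \<open>quadQ e / quadP e\<close> is the squared complementary
  modulus \<open>1 - k\<^sup>2\<close>.\<close>

definition quadQ :: "real \<Rightarrow> real" where
  "quadQ e = eta2 \<omega> c e * (e - eta1 \<omega> c e)"

lemma quad_pos:
  assumes e: "alpha0 \<omega> c < e" "e < alpha1 \<omega> c"
  shows "0 < quadP e" "0 < quadQ e"
  using eta_ordering[OF e] by (auto simp: quadP_def quadQ_def)

lemma Tper_eq_gauss_integral:
  assumes e: "alpha0 \<omega> c < e" "e < alpha1 \<omega> c"
  shows "Tper \<omega> c e = 8 * gauss_integral (quadP e) (quadQ e)"
proof -
  have P: "quadP e > 0" by (rule quad_pos[OF e])
  have "1 - (modk \<omega> c e)\<^sup>2 = quadQ e / quadP e"
    using one_minus_modk_sq[OF e] by (simp add: quadP_def quadQ_def)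
  then have Q: "quadQ e = quadP e * (1 - (modk \<omega> c e)\<^sup>2)" using P by simp
  have "1 / sqrt (quadP e * (cos x)\<^sup>2 + quadQ e * (sin x)\<^sup>2)
      = 1 / sqrt (quadP e) * (1 / sqrt (1 - (modk \<omega> c e)\<^sup>2 * (sin x)\<^sup>2))" for x
  proof -
    have "quadP e * (cos x)\<^sup>2 + quadQ e * (sin x)\<^sup>2 = quadP e * (1 - (modk \<omega> c e)\<^sup>2 * (sin x)\<^sup>2)"
      unfolding Q cos_squared_eq by (simp add: algebra_simps)
    then show ?thesis by (simp add: real_sqrt_mult)
  qed
  then have "gauss_integral (quadP e) (quadQ e) = 1 / sqrt (quadP e) * ell_K (modk \<omega> c e)"
    unfolding gauss_integral_def ell_K_def by (simp only: integral_mult_right)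
  then show ?thesis by (simp add: Tper_def gpar_def quadP_def)
qed

section \<open>Strict monotonicity of the period\<close>

lemma eta1_strict_mono:
  assumes e: "alpha0 \<omega> c < e" "e < f" "f < alpha1 \<omega> c"
  shows "eta1 \<omega> c e < eta1 \<omega> c f"
proof (rule ccontr)
  have ef: "e < alpha1 \<omega> c" "alpha0 \<omega> c < f" using e by auto
  note oe = eta_ordering[OF e(1) ef(1)] and of = eta_ordering[OF ef(2) e(3)]
  define a b a' b' where "a = eta1 \<omega> c e" "b = eta2 \<omega> c e" "a' = eta1 \<omega> c f" "b' = eta2 \<omega> c f"
  note d = this
  assume "\<not> eta1 \<omega> c e < eta1 \<omega> c f"
  then have le: "a' \<le> a" by (simp add: d)
  have s: "b = 4*c - e - a" "b' = 4*c - f - a'" using eta_sum[of e] eta_sum[of f] by (auto simp: d)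
  have p: "a * b = (e - 2*c)\<^sup>2 - 16*\<omega>" "a' * b' = (f - 2*c)\<^sup>2 - 16*\<omega>"
    using eta_prod[of e] eta_prod[of f] oe of by (auto simp: d)
  \<comment> \<open>The sum of pairwise products of the three roots has the same value for
    \<open>e\<close> and for \<open>f\<close>; this is the difference of the two expressions,
    factored. With \<open>b < e < f\<close> and \<open>a < 0 < b'\<close> both summands have a
    sign.\<close>
  have "(f - e) * (f - b) + (a - a') * (b' - a) = 0"
    using p unfolding s by algebra
  moreover have "0 < (f - e) * (f - b)" using e oe by (intro mult_pos_pos) (auto simp: d)
  moreover have "0 \<le> (a - a') * (b' - a)" using le oe of by (intro mult_nonneg_nonneg) (auto simp: d)
  ultimately show False by linarith
qed

text \<open>Both \<open>P + Q\<close> and \<open>P Q\<close> are polynomials in \<open>\<eta>\<^sub>1\<close> alone, because \<open>\<eta>\<^sub>1 + \<eta>\<^sub>2 + \<eta>\<^sub>3\<close> and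
  \<open>\<eta>\<^sub>1 \<eta>\<^sub>2 + \<eta>\<^sub>2 \<eta>\<^sub>3 + \<eta>\<^sub>3 \<eta>\<^sub>1\<close> do not depend on \<open>\<eta>\<^sub>3\<close>.\<close>

lemma Tper_strict_mono:
  assumes e: "alpha0 \<omega> c < e" "e < f" "f < alpha1 \<omega> c"
  shows "Tper \<omega> c e < Tper \<omega> c f"
proof -
  have ef: "e < alpha1 \<omega> c" "alpha0 \<omega> c < f" using e by auto
  note oe = eta_ordering[OF e(1) ef(1)] and of = eta_ordering[OF ef(2) e(3)]
  \<comment> \<open>\<open>K\<close> is the constant sum of pairwise products. With
    \<open>y = - eta1\<close>, \<open>p y\<close> is \<open>eta2 * eta3\<close> and
    \<open>q y\<close> is \<open>(eta3 - eta1) * (eta2 - eta1)\<close>, so that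
    \<open>quadP * quadQ\<close> becomes \<open>p y * q y\<close>.\<close>
  define K where "K = 4*c\<^sup>2 - 16*\<omega>"
  define p where "p y = K + 4*c*y + y\<^sup>2" for y
  define q where "q y = K + 8*c*y + 3*y\<^sup>2" for y
  define y z where "y = - eta1 \<omega> c e" and "z = - eta1 \<omega> c f"
  have zy: "0 < z" "z < y" using eta1_strict_mono[OF e] of by (auto simp: y_def z_def)
  have vieta: "x * eta2 \<omega> c x = p (- eta1 \<omega> c x)"
       "(x - eta1 \<omega> c x) * (eta2 \<omega> c x - eta1 \<omega> c x) = q (- eta1 \<omega> c x)"
       "quadP x + quadQ x = 2*K + 12*c*(- eta1 \<omega> c x) + 3*(- eta1 \<omega> c x)\<^sup>2"
    if A: "0 < polyA \<omega> c x" for x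
  proof -
    have s: "eta2 \<omega> c x = 4*c - x - eta1 \<omega> c x" using eta_sum[of x] by simp
    have pr: "eta1 \<omega> c x * eta2 \<omega> c x = (x - 2*c)\<^sup>2 - 16*\<omega>" using eta_prod[of x] A by simp
    show "x * eta2 \<omega> c x = p (- eta1 \<omega> c x)"
      using pr unfolding s p_def K_def by algebra
    show "(x - eta1 \<omega> c x) * (eta2 \<omega> c x - eta1 \<omega> c x) = q (- eta1 \<omega> c x)"
      using pr unfolding s q_def K_def by algebra
    show "quadP x + quadQ x = 2*K + 12*c*(- eta1 \<omega> c x) + 3*(- eta1 \<omega> c x)\<^sup>2"
      using pr unfolding quadP_def quadQ_def s K_def by algebra
  qed
  \<comment> \<open>As \<open>c\<close> may be negative, the sign comes from reading these
    quantities as \<open>eta2 + eta3\<close>.\<close>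
  have cz: "0 < 4*c + z" "0 < 4*c + y"
    using eta_sum[of f] eta_sum[of e] of oe by (auto simp: z_def y_def)
  have pz: "p z < p y"
  proof -
    have "p y - p z = (y - z) * (4*c + y + z)" unfolding p_def by algebra
    also have "\<dots> > 0" using zy cz by (intro mult_pos_pos) auto
    finally show ?thesis by simp
  qed
  have qz: "q z < q y"
  proof -
    have "q y - q z = (y - z) * ((4*c + y) + (4*c + z) + 2*y + 2*z)" unfolding q_def by algebra
    also have "\<dots> > 0" using zy cz by (intro mult_pos_pos) auto
    finally show ?thesis by simp
  qed
  have pq: "quadP x * quadQ x = (x * eta2 \<omega> c x) * ((x - eta1 \<omega> c x) * (eta2 \<omega> c x - eta1 \<omega> c x))" for x
    unfolding quadP_def quadQ_def by algebra
  have "gauss_integral (quadP e) (quadQ e) < gauss_integral (quadP f) (quadQ f)"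
  proof (rule gauss_integral_less)
    have "0 < p z" "0 < q z"
      using of unfolding z_def vieta(1)[OF of(2), symmetric] vieta(2)[OF of(2), symmetric] by auto
    then show "quadP f * quadQ f < quadP e * quadQ e"
      unfolding pq vieta(1,2)[OF of(2)] vieta(1,2)[OF oe(2)]
      using pz qz unfolding y_def z_def by (intro mult_strict_mono) auto
    have "(2*K + 12*c*y + 3*y\<^sup>2) - (2*K + 12*c*z + 3*z\<^sup>2) = 3 * ((y - z) * (4*c + y + z))" by algebra
    also have "\<dots> > 0" using zy cz by (intro mult_pos_pos) auto
    finally show "quadP f + quadQ f < quadP e + quadQ e"
      unfolding vieta(3)[OF of(2)] vieta(3)[OF oe(2)] y_def z_def by linarith
  qed (use quad_pos[OF e(1) ef(1)] quad_pos[OF ef(2) e(3)] in auto)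
  then show ?thesis using Tper_eq_gauss_integral[OF e(1) ef(1)] Tper_eq_gauss_integral[OF ef(2) e(3)] by simp
qed

section \<open>Continuity of the period and its divergence at \<open>alpha1\<close>\<close>

lemma continuous_on_eta:
  "continuous_on S (eta1 \<omega> c)" "continuous_on S (eta2 \<omega> c)"
  unfolding eta1_def polyA_def eta2_def by (intro continuous_intros; simp)+

lemma continuous_on_Tper: "continuous_on {alpha0 \<omega> c<..<alpha1 \<omega> c} (Tper \<omega> c)"
proof -
  have "continuous_on {alpha0 \<omega> c<..<alpha1 \<omega> c} (\<lambda>e. 8 * gauss_integral (quadP e) (quadQ e))"
    using quad_pos unfolding quadP_def quadQ_def
    by (intro continuous_intros continuous_on_gauss_integral continuous_on_eta) auto
  then show ?thesis
    by (rule continuous_on_cong[THEN iffD1, rotated 2]) (auto simp: Tper_eq_gauss_integral)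
qed

lemma polyA_alpha1: "sqrt (polyA \<omega> c (alpha1 \<omega> c)) = 4 * sqrt \<omega> - 2*c"
proof -
  have r2: "(sqrt \<omega>)\<^sup>2 = \<omega>" using omega_pos by simp
  have "polyA \<omega> c (alpha1 \<omega> c) = (4 * sqrt \<omega> - 2*c)\<^sup>2"
    using r2 unfolding polyA_def alpha1_def by (simp add: power2_eq_square algebra_simps)
  then show ?thesis using sqrt_omega_bounds by simp
qed

lemma eta_tendsto_alpha1:
  "((\<lambda>e. e) \<longlongrightarrow> alpha1 \<omega> c) (at_left (alpha1 \<omega> c))"
  "(eta1 \<omega> c \<longlongrightarrow> 2*c - 4 * sqrt \<omega>) (at_left (alpha1 \<omega> c))"
  "(eta2 \<omega> c \<longlongrightarrow> 0) (at_left (alpha1 \<omega> c))"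
proof -
  have "(eta1 \<omega> c \<longlongrightarrow> eta1 \<omega> c (alpha1 \<omega> c)) (at_left (alpha1 \<omega> c))"
    "(eta2 \<omega> c \<longlongrightarrow> eta2 \<omega> c (alpha1 \<omega> c)) (at_left (alpha1 \<omega> c))"
    using continuous_on_eta[of UNIV]
    by (auto simp: continuous_on_def intro: tendsto_within_subset)
  moreover have "eta1 \<omega> c (alpha1 \<omega> c) = 2*c - 4 * sqrt \<omega>" "eta2 \<omega> c (alpha1 \<omega> c) = 0"
    by (auto simp: eta1_def eta2_def polyA_alpha1) (auto simp: alpha1_def)
  ultimately show "(eta1 \<omega> c \<longlongrightarrow> 2*c - 4 * sqrt \<omega>) (at_left (alpha1 \<omega> c))"
    "(eta2 \<omega> c \<longlongrightarrow> 0) (at_left (alpha1 \<omega> c))" by auto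
qed (auto intro: tendsto_ident_at)

lemma eventually_alpha: "eventually (\<lambda>e. alpha0 \<omega> c < e \<and> e < alpha1 \<omega> c) (at_left (alpha1 \<omega> c))"
  using eventually_at_left_real[OF alpha_bounds(2)] by simp

lemma Tper_at_top: "filterlim (Tper \<omega> c) at_top (at_left (alpha1 \<omega> c))"
proof -
  let ?F = "at_left (alpha1 \<omega> c)"
  \<comment> \<open>The limit of \<open>quadP\<close> plus 1: an eventual strict upper bound that
    stays positive in the algebraic case, where the limit is 0.\<close>
  define M where "M = alpha1 \<omega> c * (4 * sqrt \<omega> - 2*c) + 1"
  have "0 \<le> alpha1 \<omega> c * (4 * sqrt \<omega> - 2*c)"
    using alpha_bounds sqrt_omega_bounds by (intro mult_nonneg_nonneg) auto
  then have M: "M > 0" by (simp add: M_def)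
  have "(quadP \<longlongrightarrow> alpha1 \<omega> c * (0 - (2*c - 4 * sqrt \<omega>))) ?F"
    unfolding quadP_def by (intro tendsto_intros eta_tendsto_alpha1)
  moreover have "alpha1 \<omega> c * (0 - (2*c - 4 * sqrt \<omega>)) < M" by (simp add: M_def)
  ultimately have PM: "eventually (\<lambda>e. quadP e < M) ?F" by (rule order_tendstoD)
  have "(quadQ \<longlongrightarrow> 0 * (alpha1 \<omega> c - (2*c - 4 * sqrt \<omega>))) ?F"
    unfolding quadQ_def by (intro tendsto_intros eta_tendsto_alpha1)
  then have Q0: "((\<lambda>e. sqrt (quadQ e)) \<longlongrightarrow> 0) ?F"
    using tendsto_real_sqrt by fastforce
  have Qp: "eventually (\<lambda>e. 0 < sqrt (quadQ e)) ?F"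
    using eventually_alpha by eventually_elim (simp add: quad_pos)
  have "LIM e ?F. (sqrt M * (pi/2)) / sqrt (quadQ e) :> at_top"
    unfolding divide_inverse[of _ "sqrt (quadQ _)"] using M
    by (intro filterlim_tendsto_pos_mult_at_top[OF tendsto_const _ filterlim_inverse_at_top[OF Q0 Qp]]) auto
  then have "LIM e ?F. 1 + (sqrt M * (pi/2)) / sqrt (quadQ e) :> at_top"
    by (intro filterlim_tendsto_add_at_top[OF tendsto_const])
  then have "LIM e ?F. ln (1 + (sqrt M * (pi/2)) / sqrt (quadQ e)) :> at_top"
    by (rule filterlim_compose[OF ln_at_top])
  then have "LIM e ?F. (8 / sqrt M) * ln (1 + (sqrt M * (pi/2)) / sqrt (quadQ e)) :> at_top"
    using M by (intro filterlim_tendsto_pos_mult_at_top[OF tendsto_const]) auto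
  then show ?thesis
  proof (rule filterlim_at_top_mono)
    show "eventually (\<lambda>e. 8 / sqrt M * ln (1 + sqrt M * (pi / 2) / sqrt (quadQ e)) \<le> Tper \<omega> c e) ?F"
      using eventually_alpha PM
    proof eventually_elim
      case (elim e)
      then have "ln (1 + sqrt M * (pi/2) / sqrt (quadQ e)) / sqrt M \<le> gauss_integral (quadP e) (quadQ e)"
        using quad_pos[of e] by (intro gauss_integral_ge_log) auto
      then show ?case using elim by (simp add: Tper_eq_gauss_integral)
    qed
  qed
qed

section \<open>Inverting the period for large \<open>L\<close>\<close>

lemma ex_Tper_eq:
  assumes "alpha0 \<omega> c < e" "e < alpha1 \<omega> c" "Tper \<omega> c e < T"
  shows "\<exists>f. e < f \<and> f < alpha1 \<omega> c \<and> Tper \<omega> c f = T"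
proof -
  have "eventually (\<lambda>f. T \<le> Tper \<omega> c f) (at_left (alpha1 \<omega> c))"
    using Tper_at_top by (simp add: filterlim_at_top)
  moreover have "eventually (\<lambda>f. e < f \<and> f < alpha1 \<omega> c) (at_left (alpha1 \<omega> c))"
    using eventually_at_left_real[OF assms(2)] by simp
  ultimately have "eventually (\<lambda>f. e < f \<and> f < alpha1 \<omega> c \<and> T \<le> Tper \<omega> c f) (at_left (alpha1 \<omega> c))"
    by eventually_elim simp
  then obtain f where f: "e < f" "f < alpha1 \<omega> c" "T \<le> Tper \<omega> c f"
    using eventually_happens'[OF trivial_limit_at_left_real] by blast
  have "continuous_on {e..f} (Tper \<omega> c)"
    using assms f by (intro continuous_on_subset[OF continuous_on_Tper]) auto
  then obtain x where "e \<le> x" "x \<le> f" "Tper \<omega> c x = T"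
    using IVT'[of "Tper \<omega> c" e T f] assms f by auto
  then show ?thesis using assms f by (intro exI[of _ x]) (auto simp: order_le_less)
qed

text \<open>Existence comes from the intermediate value theorem and uniqueness from strict
  monotonicity, so the definite description in \<open>eta3L\<close> denotes the root.\<close>

lemma eta3L_properties:
  assumes "alpha0 \<omega> c < e" "e < alpha1 \<omega> c" "Tper \<omega> c e < 2*L"
  shows "e < eta3L \<omega> c L" "eta3L \<omega> c L < alpha1 \<omega> c" "Tper \<omega> c (eta3L \<omega> c L) = 2*L"
proof -
  obtain f where f: "e < f" "f < alpha1 \<omega> c" "Tper \<omega> c f = 2*L" using ex_Tper_eq[OF assms] by blast
  have "eta3L \<omega> c L = f"
    unfolding eta3L_def
  proof (rule the_equality)
    fix x assume x: "alpha0 \<omega> c < x \<and> x < alpha1 \<omega> c \<and> Tper \<omega> c x = 2*L"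
    show "x = f"
      using Tper_strict_mono[of x f] Tper_strict_mono[of f x] x f assms by (cases x f rule: linorder_cases) auto
  qed (use f assms in auto)
  then show "e < eta3L \<omega> c L" "eta3L \<omega> c L < alpha1 \<omega> c" "Tper \<omega> c (eta3L \<omega> c L) = 2*L"
    using f by auto
qed

text \<open>Since the base point \<open>e\<close> may be taken arbitrarily close to
  \<open>alpha1\<close>, this already contains the convergence of \<open>eta3L\<close>.\<close>

lemma eventually_eta3L:
  assumes "alpha0 \<omega> c < e" "e < alpha1 \<omega> c"
  shows "eventually (\<lambda>L. e < eta3L \<omega> c L \<and> eta3L \<omega> c L < alpha1 \<omega> c \<and> Tper \<omega> c (eta3L \<omega> c L) = 2*L) at_top"
  using eventually_gt_at_top[of "Tper \<omega> c e / 2"]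
  by eventually_elim (use eta3L_properties[OF assms] in auto)

lemma eta3L_tendsto: "filterlim (eta3L \<omega> c) (at_left (alpha1 \<omega> c)) at_top"
proof -
  obtain m where m: "alpha0 \<omega> c < m" "m < alpha1 \<omega> c" using dense[OF alpha_bounds(2)] by blast
  have "eventually (\<lambda>L. eta3L \<omega> c L \<in> {..<alpha1 \<omega> c} \<and> eta3L \<omega> c L \<noteq> alpha1 \<omega> c) at_top"
    using eventually_eta3L[OF m] by eventually_elim simp
  moreover have "(eta3L \<omega> c \<longlongrightarrow> alpha1 \<omega> c) at_top"
  proof (rule order_tendstoI)
    fix a assume "a < alpha1 \<omega> c"
    \<comment> \<open>\<open>a\<close> may lie at or below \<open>alpha0\<close>; the maximum with
      \<open>m\<close> moves it into the admissible interval.\<close>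
    then have "alpha0 \<omega> c < max a m" "max a m < alpha1 \<omega> c" using m by auto
    from eventually_eta3L[OF this] show "eventually (\<lambda>L. a < eta3L \<omega> c L) at_top"
      by eventually_elim simp
  next
    fix a assume "alpha1 \<omega> c < a"
    then show "eventually (\<lambda>L. eta3L \<omega> c L < a) at_top"
      using eventually_eta3L[OF m] by (auto elim: eventually_mono)
  qed
  ultimately show ?thesis by (simp add: filterlim_at)
qed

section \<open>The mass of the periodic waves and its limit\<close>

definition mass :: "real \<Rightarrow> real" where
  "mass e = 4 * sqrt (e / (e - eta2 \<omega> c e)) * (sqrt (beta2 \<omega> c e) *
     integral {-(pi/2)..pi/2} (\<lambda>\<phi>. sqrt (1 - (modk \<omega> c e)\<^sup>2 * (sin \<phi>)\<^sup>2) / (1 + beta2 \<omega> c e * (sin \<phi>)\<^sup>2)))"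

text \<open>The Jacobian of the amplitude substitution cancels one square root of
  \<open>1 - k\<^sup>2 sin\<^sup>2\<close>. The prefactor is split so that \<open>sqrt beta2\<close>
  stands next to the integral, as \<open>third_kind_integral_approx\<close> with
  \<open>B = sqrt beta2\<close> expects.\<close>

lemma integral_PhiL:
  assumes e: "alpha0 \<omega> c < eta3L \<omega> c L" "eta3L \<omega> c L < alpha1 \<omega> c" and T: "Tper \<omega> c (eta3L \<omega> c L) = 2*L"
  shows "integral {-L..L} (\<lambda>x. (PhiL \<omega> c L x)\<^sup>2) = mass (eta3L \<omega> c L)"
proof -
  define e k g b where "e = eta3L \<omega> c L" and "k = modk \<omega> c e" and "g = gpar \<omega> c e" and "b = beta2 \<omega> c e"
  have e': "alpha0 \<omega> c < e" "e < alpha1 \<omega> c" using assms by (auto simp: e_def)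
  note o = eta_ordering[OF e']
  have k1: "k\<^sup>2 < 1" unfolding k_def by (rule modk_sq_less_one[OF e'])
  have g: "g > 0" unfolding g_def gpar_def using o by auto
  have b: "b > 0" unfolding b_def beta2_eq[OF e'] using o by auto
  \<comment> \<open>\<open>Tper\<close> is \<open>4*g*K\<close> and equals \<open>2*L\<close>, so
    \<open>{-L..L}\<close> corresponds to amplitudes in \<open>{-(pi/2)..pi/2}\<close>.\<close>
  have L: "L = 2*g*ell_K k" using T unfolding Tper_def e_def[symmetric] k_def g_def by simp
  define h where "h \<phi> = e * (1 - k\<^sup>2 * (sin \<phi>)\<^sup>2) / (1 + b * (sin \<phi>)\<^sup>2)" for \<phi>
  have den: "1 + b * (sin x)\<^sup>2 > 0" for x using b by (intro add_pos_nonneg) auto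
  note num = one_minus_k2_sin2_pos[OF k1]
  have eq: "(PhiL \<omega> c L x)\<^sup>2 = h (jacobi_am k (x / (2*g)))" for x
  proof -
    have "0 \<le> h \<phi>" for \<phi> unfolding h_def using o num[of \<phi>] den[of \<phi>] by simp
    moreover have "PhiL \<omega> c L x = sqrt (h (jacobi_am k (x / (2*g))))"
      using num unfolding PhiL_def Let_def h_def jacobi_dn_def jacobi_sn_def e_def[symmetric]
        k_def[symmetric] g_def[symmetric] b_def[symmetric]
      by (simp add: less_imp_le)
    ultimately show ?thesis by simp
  qed
  have ch: "continuous_on UNIV h"
    unfolding h_def using den by (intro continuous_intros) (auto simp: less_imp_neq[symmetric])
  have hs: "h \<phi> / sqrt (1 - k\<^sup>2 * (sin \<phi>)\<^sup>2) = e * (sqrt (1 - k\<^sup>2 * (sin \<phi>)\<^sup>2) / (1 + b * (sin \<phi>)\<^sup>2))" for \<phi>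
  proof -
    have "(1 - k\<^sup>2 * (sin \<phi>)\<^sup>2) / sqrt (1 - k\<^sup>2 * (sin \<phi>)\<^sup>2) = sqrt (1 - k\<^sup>2 * (sin \<phi>)\<^sup>2)"
      using num[of \<phi>] by (simp add: real_div_sqrt)
    moreover have "h \<phi> / sqrt (1 - k\<^sup>2 * (sin \<phi>)\<^sup>2) =
        e * ((1 - k\<^sup>2 * (sin \<phi>)\<^sup>2) / sqrt (1 - k\<^sup>2 * (sin \<phi>)\<^sup>2) / (1 + b * (sin \<phi>)\<^sup>2))"
      unfolding h_def by simp
    ultimately show ?thesis by (simp only:)
  qed
  have "integral {-L..L} (\<lambda>x. (PhiL \<omega> c L x)\<^sup>2) =
     2 * g * integral {-(pi/2)..pi/2} (\<lambda>\<phi>. h \<phi> / sqrt (1 - k\<^sup>2 * (sin \<phi>)\<^sup>2))"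
    unfolding eq using integral_jacobi_am[OF k1 g ch] by (simp only: L[symmetric])
  also have "\<dots> = 2 * g * e * integral {-(pi/2)..pi/2} (\<lambda>\<phi>. sqrt (1 - k\<^sup>2 * (sin \<phi>)\<^sup>2) / (1 + b * (sin \<phi>)\<^sup>2))"
    unfolding hs integral_mult_right by simp
  also have "2 * g * e = 4 * sqrt (e / (e - eta2 \<omega> c e)) * sqrt b"
  proof -
    let ?d = "eta2 \<omega> c e - eta1 \<omega> c e"
    have d: "?d > 0" using o by simp
    have "sqrt (e / (e - eta2 \<omega> c e)) * sqrt b = sqrt (e / (e - eta2 \<omega> c e) * b)"
      by (rule real_sqrt_mult[symmetric])
    also have "e / (e - eta2 \<omega> c e) * b = e / ?d" unfolding b_def beta2_eq[OF e'] using o by simp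
    also have "sqrt (e / ?d) = e / sqrt (e * ?d)"
      using o(1) by (simp add: real_sqrt_divide real_sqrt_mult real_div_sqrt flip: divide_divide_eq_left)
    finally show ?thesis by (simp add: g_def gpar_def)
  qed
  finally show ?thesis by (simp add: mass_def e_def k_def b_def mult.assoc)
qed

text \<open>The limit is written with \<open>X = 1 / sqrt beta2\<close>, which converges in both
  cases; in the algebraic case \<open>beta2\<close> is unbounded and \<open>X\<close> tends to
  0.\<close>

lemma mass_tendsto:
  "(mass \<longlongrightarrow> 8 * (pi/2 - arctan (sqrt ((4 * sqrt \<omega> - 2*c) / alpha1 \<omega> c)))) (at_left (alpha1 \<omega> c))"
proof -
  let ?F = "at_left (alpha1 \<omega> c)"
  define I where "I e = integral {-(pi/2)..pi/2}
    (\<lambda>\<phi>. sqrt (1 - (modk \<omega> c e)\<^sup>2 * (sin \<phi>)\<^sup>2) / (1 + beta2 \<omega> c e * (sin \<phi>)\<^sup>2))" for e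
  define X where "X e = sqrt ((eta2 \<omega> c e - eta1 \<omega> c e) / (e - eta2 \<omega> c e))" for e
  \<comment> \<open>The error bound \<open>pi * sqrt ((1 - k\<^sup>2) / beta2)\<close> written out.
    The factor \<open>eta2 - eta1\<close>, which tends to 0 in the algebraic case, has cancelled,
    and the remaining factor \<open>eta2\<close> forces the limit 0.\<close>
  define E where "E e = pi * sqrt (eta2 \<omega> c e * (e - eta1 \<omega> c e) / (e * (e - eta2 \<omega> c e)))" for e
  have a: "alpha1 \<omega> c \<noteq> 0" using alpha_bounds by simp
  have "(E \<longlongrightarrow> pi * sqrt (0 * (alpha1 \<omega> c - (2*c - 4 * sqrt \<omega>)) / (alpha1 \<omega> c * (alpha1 \<omega> c - 0)))) ?F"
    unfolding E_def by (intro tendsto_intros eta_tendsto_alpha1) (use a in auto)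
  then have E: "(E \<longlongrightarrow> 0) ?F" by simp
  have "(X \<longlongrightarrow> sqrt ((0 - (2*c - 4 * sqrt \<omega>)) / (alpha1 \<omega> c - 0))) ?F"
    unfolding X_def by (intro tendsto_intros eta_tendsto_alpha1) (use a in auto)
  then have X: "(X \<longlongrightarrow> sqrt ((4 * sqrt \<omega> - 2*c) / alpha1 \<omega> c)) ?F" by simp
  have bnd: "eventually (\<lambda>e. norm (sqrt (beta2 \<omega> c e) * I e - 2 * (pi/2 - arctan (X e))) \<le> E e) ?F"
    using eventually_alpha
  proof eventually_elim
    case (elim e)
    then have e: "alpha0 \<omega> c < e" "e < alpha1 \<omega> c" by auto
    note o = eta_ordering[OF e]
    define B where "B = sqrt (beta2 \<omega> c e)"
    have b: "beta2 \<omega> c e > 0" unfolding beta2_eq[OF e] using o by auto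
    then have B: "B > 0" "B\<^sup>2 = beta2 \<omega> c e" by (auto simp: B_def)
    have XB: "X e > 0" "1 / X e = B"
      using o unfolding X_def B_def beta2_eq[OF e] by (auto simp: real_sqrt_divide)
    have "arctan (1 / X e) = pi/2 - arctan (X e)" using XB(1) by (rule arctan_reciprocal)
    then have at: "arctan B = pi/2 - arctan (X e)" by (simp only: XB(2))
    have "(1 - (modk \<omega> c e)\<^sup>2) / B\<^sup>2 = eta2 \<omega> c e * (e - eta1 \<omega> c e) / (e * (e - eta2 \<omega> c e))"
      unfolding one_minus_modk_sq[OF e] B beta2_eq[OF e] using o by simp
    then show ?case
      using third_kind_integral_approx[OF modk_sq_less_one[OF e] B(1)]
      unfolding at E_def I_def B_def[symmetric]
      unfolding B(2)[symmetric] real_norm_def by (simp only:)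
  qed
  have "((\<lambda>e. (sqrt (beta2 \<omega> c e) * I e - 2 * (pi/2 - arctan (X e))) + 2 * (pi/2 - arctan (X e))) \<longlongrightarrow>
      0 + 2 * (pi/2 - arctan (sqrt ((4 * sqrt \<omega> - 2*c) / alpha1 \<omega> c)))) ?F"
    by (intro tendsto_add Lim_null_comparison[OF bnd E] tendsto_intros X)
  then have BI: "((\<lambda>e. sqrt (beta2 \<omega> c e) * I e) \<longlongrightarrow> 2 * (pi/2 - arctan (sqrt ((4 * sqrt \<omega> - 2*c) / alpha1 \<omega> c)))) ?F"
    by simp
  have "((\<lambda>e. 4 * sqrt (e / (e - eta2 \<omega> c e)) * (sqrt (beta2 \<omega> c e) * I e)) \<longlongrightarrow>
     4 * sqrt (alpha1 \<omega> c / (alpha1 \<omega> c - 0)) * (2 * (pi/2 - arctan (sqrt ((4 * sqrt \<omega> - 2*c) / alpha1 \<omega> c))))) ?F"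
    by (intro tendsto_intros eta_tendsto_alpha1 BI) (use a in auto)
  then show ?thesis using a by (simp add: mass_def[abs_def] I_def)
qed

text \<open>Brings both values to the form of the limit in \<open>mass_tendsto\<close>: by the
  reciprocal rule for \<open>arctan\<close> in the hyperbolic case, and with
  \<open>arctan 0 = 0\<close> in the algebraic one.\<close>

lemma integral_Phi:
  "integral UNIV (\<lambda>x. (Phi \<omega> c x)\<^sup>2) = 8 * (pi/2 - arctan (sqrt ((4 * sqrt \<omega> - 2*c) / alpha1 \<omega> c)))"
  using adm
proof
  assume h: "\<omega> > c\<^sup>2/4"
  then have "\<bar>c\<bar> < 2 * sqrt \<omega>"
    using omega_pos by (intro power2_less_imp_less[of "\<bar>c\<bar>"]) (auto simp: power_mult_distrib)
  then have rc: "2 * sqrt \<omega> + c > 0" "2 * sqrt \<omega> - c > 0" by auto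
  let ?x = "sqrt ((4 * sqrt \<omega> - 2*c) / alpha1 \<omega> c)"
  have "4 * sqrt \<omega> - 2*c = 2 * (2 * sqrt \<omega> - c)" "alpha1 \<omega> c = 2 * (2 * sqrt \<omega> + c)"
    by (simp_all add: alpha1_def)
  then have x: "?x = sqrt ((2 * sqrt \<omega> - c) / (2 * sqrt \<omega> + c))"
    by (simp only: mult_divide_mult_cancel_left_if) simp
  then have "?x > 0" using rc by simp
  then have "arctan (1 / ?x) = pi/2 - arctan ?x" by (rule arctan_reciprocal)
  moreover have "1 / ?x = sqrt ((2 * sqrt \<omega> + c) / (2 * sqrt \<omega> - c))"
    unfolding x by (simp add: real_sqrt_divide)
  ultimately show ?thesis
    unfolding integral_Phi_hyperbolic[OF h] by (simp only:)
next
  assume h: "\<omega> = c\<^sup>2/4 \<and> c > 0"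
  then have "sqrt \<omega> = c / 2" by (intro real_sqrt_unique) (auto simp: power_divide)
  then have "4 * sqrt \<omega> - 2*c = 0" by simp
  then show ?thesis using integral_Phi_algebraic[of \<omega> c] h by (simp only:) simp
qed

end

theorem theorem4p1:
  fixes \<omega> c :: real
  assumes "\<omega> > c\<^sup>2/4 \<or> (\<omega> = c\<^sup>2/4 \<and> c > 0)"
  shows "((\<lambda>L. integral {-L..L} (\<lambda>x. (PhiL \<omega> c L x)\<^sup>2))
            \<longlongrightarrow> integral UNIV (\<lambda>x. (Phi \<omega> c x)\<^sup>2)) at_top"
proof -
  obtain m where m: "alpha0 \<omega> c < m" "m < alpha1 \<omega> c"
    using dense[OF alpha_bounds(2)[OF assms]] by blast
  have "((\<lambda>L. mass \<omega> c (eta3L \<omega> c L)) \<longlongrightarrow> integral UNIV (\<lambda>x. (Phi \<omega> c x)\<^sup>2)) at_top"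
    unfolding integral_Phi[OF assms]
    by (rule filterlim_compose[OF mass_tendsto[OF assms] eta3L_tendsto[OF assms]])
  then show ?thesis
  \<comment> \<open>The mass formula is available once \<open>L\<close> is large enough for
    \<open>eta3L\<close> to solve the period equation, hence an eventual equality.\<close>
  proof (rule Lim_transform_eventually)
    show "eventually (\<lambda>L. mass \<omega> c (eta3L \<omega> c L) = integral {-L..L} (\<lambda>x. (PhiL \<omega> c L x)\<^sup>2)) at_top"
      using eventually_eta3L[OF assms m]
    proof eventually_elim
      case (elim L)
      then show ?case using m by (subst integral_PhiL[OF assms]) auto
    qed
  qed
qed

end
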